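(* Let $\mathcal{T}$ be a triangulated category with a fixed $t$-structure $\mathcal{U}=(\mathcal{U}_{\leq 0},\mathcal{U}_{\geq 0})$, and write $\mathcal{T}^b=\mathcal{U}_{\mathbb{N}}$, which carries the bounded $t$-structure $\mathcal{U}^b$. Then there is a bijective correspondence $$\{t\text{-structures } \mathcal{V} \text{ on } \mathcal{T} \text{ with } d(\mathcal{U},\mathcal{V})<+\infty\}\longrightarrow \{t\text{-structures } \mathcal{V}' \text{ on } \mathcal{T}^b \text{ with } d(\mathcal{U}^b,\mathcal{V}')<+\infty\}$$ sending $\mathcal{V}$ to its restriction $\mathcal{V}^b$ on $\mathcal{T}^b$.
   Context: Let $\Sigma$ denote the translation functor of a triangulated category. A $t$-structure $\mathcal{U}=(\mathcal{U}_{\leq 0},\mathcal{U}_{\geq 0})$ on a triangulated category $\mathcal{T}$ consists of two full subcategories (closed under isomorphisms) such that: (T1) $\Sigma\mathcal{U}_{\leq 0}\subseteq\mathcal{U}_{\leq 0}$ and $\Sigma^{-1}\mathcal{U}_{\geq 0}\subseteq\mathcal{U}_{\geq 0}$; (T2) $\mathrm{Hom}_{\mathcal{T}}(X,Y)=0$ for all $X\in\mathcal{U}_{\leq 0}$, $Y\in\Sigma^{-1}\mathcal{U}_{\geq 0}$; (T3) every $Z\in\mathcal{T}$ fits into an exact triangle $X\to Z\to \Sigma^{-1}(Y)\to\Sigma(X)$ with $X\in\mathcal{U}_{\leq 0}$, $Y\in\mathcal{U}_{\geq 0}$. For $n\in\mathbb{Z}$ put $\mathcal{U}_{\leq n}=\Sigma^{-n}\mathcal{U}_{\leq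 0}$ and $\mathcal{U}_{\geq n}=\Sigma^{-n}\mathcal{U}_{\geq 0}$. For $m\leq n$ put $\mathcal{U}_{[m,n]}=\mathcal{U}_{\geq m}\cap\mathcal{U}_{\leq n}$, and put $\mathcal{U}_{\mathbb{N}}=\bigcup_{n\geq 0}\mathcal{U}_{[-n,n]}$; it is the smallest triangulated full subcategory of $\mathcal{T}$ containing the heart $\mathcal{U}_0=\mathcal{U}_{\leq 0}\cap\mathcal{U}_{\geq 0}$. The $t$-structure $\mathcal{U}$ restricts to the $t$-structure $\mathcal{U}^b=(\mathcal{U}_{\mathbb{N}}\cap\mathcal{U}_{\leq 0},\ \mathcal{U}_{\mathbb{N}}\cap\mathcal{U}_{\geq 0})$ on $\mathcal{U}_{\mathbb{N}}$. A $t$-structure $\mathcal{U}$ on $\mathcal{T}$ is bounded if $\bigcup_{n}\mathcal{U}_{\leq n}=\mathcal{T}=\bigcup_{n}\mathcal{U}_{\geq n}$. The same notation is used for any other $t$-structure $\mathcal{V}$; when $d(\mathcal{U},\mathcal{V})<+\infty$ one has $\mathcal{V}_{\mathbb{N}}=\mathcal{U}_{\mathbb{N}}=\mathcal{T}^b$, so $\mathcal{V}^b=(\mathcal{T}^b\cap\mathcal{V}_{\leq 0},\ \mathcal{T}^b\cap\mathcal{V}_{\geq 0})$ is a $t$-structure on $\mathcal{T}^b$. The distance $d(\mathcal{U},\mathcal{V})$ of two $t$-structures on the same triangulated category is the smallest natural number $d\geq 0$ such that $\mathcal{V}_{\leq m}\subseteq\mathcal{U}_{\leq 0}\subseteq\mathcal{V}_{\leq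 m+d}$ for some integer $m$; if no such $d$ exists, $d(\mathcal{U},\mathcal{V})=+\infty$. *)

theory Defs
  imports "HOL-Algebra.Group" "HOL-Library.Extended_Nat"
begin

section \<open>Triangulated categories\<close>

text \<open>
  A category is given by a set of objects and a set of arrows with domain and codomain, so Hom sets
  are disjoint. An exact triangle X -> Y -> Z -> Sigma X is given by its three arrows, which
  determine the objects.
\<close>

record ('o, 'm) tcat =
  Obj :: "'o set"
  Arr :: "'m set"
  Dom :: "'m \<Rightarrow> 'o"
  Cod :: "'m \<Rightarrow> 'o"
  Ident :: "'o \<Rightarrow> 'm"
  Comp :: "'m \<Rightarrow> 'm \<Rightarrow> 'm"
  Add :: "'m \<Rightarrow> 'm \<Rightarrow> 'm"
  ZeroArr :: "'o \<Rightarrow> 'o \<Rightarrow> 'm"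
  ShiftObj :: "'o \<Rightarrow> 'o"
  ShiftArr :: "'m \<Rightarrow> 'm"
  Tri :: "('m \<times> 'm \<times> 'm) set"

definition Hom :: "('o, 'm) tcat \<Rightarrow> 'o \<Rightarrow> 'o \<Rightarrow> 'm set" where
  "Hom T X Y = {f \<in> Arr T. Dom T f = X \<and> Cod T f = Y}"

definition HomGroup :: "('o, 'm) tcat \<Rightarrow> 'o \<Rightarrow> 'o \<Rightarrow> 'm monoid" where
  "HomGroup T X Y = \<lparr>carrier = Hom T X Y, mult = Add T, one = ZeroArr T X Y\<rparr>"

definition Neg :: "('o, 'm) tcat \<Rightarrow> 'm \<Rightarrow> 'm" where
  "Neg T f = inv\<^bsub>HomGroup T (Dom T f) (Cod T f)\<^esub> f"

definition is_iso :: "('o, 'm) tcat \<Rightarrow> 'm \<Rightarrow> bool" where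
  "is_iso T f \<longleftrightarrow> f \<in> Arr T \<and>
     (\<exists>g \<in> Hom T (Cod T f) (Dom T f).
        Comp T g f = Ident T (Dom T f) \<and> Comp T f g = Ident T (Cod T f))"

definition isomorphic :: "('o, 'm) tcat \<Rightarrow> 'o \<Rightarrow> 'o \<Rightarrow> bool" where
  "isomorphic T X Y \<longleftrightarrow> (\<exists>f \<in> Hom T X Y. is_iso T f)"

definition zero_object :: "('o, 'm) tcat \<Rightarrow> 'o \<Rightarrow> bool" where
  "zero_object T N \<longleftrightarrow> N \<in> Obj T \<and>
     (\<forall>X \<in> Obj T. (\<exists>!f. f \<in> Hom T X N) \<and> (\<exists>!f. f \<in> Hom T N X))"

definition biproduct ::
  "('o, 'm) tcat \<Rightarrow> 'o \<Rightarrow> 'o \<Rightarrow> 'o \<Rightarrow> 'm \<Rightarrow> 'm \<Rightarrow> 'm \<Rightarrow> 'm \<Rightarrow> bool" where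
  "biproduct T X Y P i1 i2 p1 p2 \<longleftrightarrow> P \<in> Obj T \<and>
     i1 \<in> Hom T X P \<and> i2 \<in> Hom T Y P \<and> p1 \<in> Hom T P X \<and> p2 \<in> Hom T P Y \<and>
     Comp T p1 i1 = Ident T X \<and> Comp T p2 i2 = Ident T Y \<and>
     Comp T p1 i2 = ZeroArr T Y X \<and> Comp T p2 i1 = ZeroArr T X Y \<and>
     Add T (Comp T i1 p1) (Comp T i2 p2) = Ident T P"

locale category =
  fixes T :: "('o, 'm) tcat"
  assumes arr_obj: "f \<in> Arr T \<Longrightarrow> Dom T f \<in> Obj T \<and> Cod T f \<in> Obj T"
    and ident_hom: "X \<in> Obj T \<Longrightarrow> Ident T X \<in> Hom T X X"
    and comp_hom: "\<lbrakk>f \<in> Hom T X Y; g \<in> Hom T Y Z\<rbrakk> \<Longrightarrow> Comp T g f \<in> Hom T X Z"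
    and comp_ident_right: "f \<in> Hom T X Y \<Longrightarrow> Comp T f (Ident T X) = f"
    and comp_ident_left: "f \<in> Hom T X Y \<Longrightarrow> Comp T (Ident T Y) f = f"
    and comp_assoc: "\<lbrakk>f \<in> Hom T W X; g \<in> Hom T X Y; h \<in> Hom T Y Z\<rbrakk> \<Longrightarrow>
        Comp T h (Comp T g f) = Comp T (Comp T h g) f"

locale additive_category = category +
  assumes hom_group: "\<lbrakk>X \<in> Obj T; Y \<in> Obj T\<rbrakk> \<Longrightarrow> comm_group (HomGroup T X Y)"
    and comp_add_right: "\<lbrakk>f \<in> Hom T X Y; f' \<in> Hom T X Y; g \<in> Hom T Y Z\<rbrakk> \<Longrightarrow>
        Comp T g (Add T f f') = Add T (Comp T g f) (Comp T g f')"
    and comp_add_left: "\<lbrakk>f \<in> Hom T X Y; g \<in> Hom T Y Z; g' \<in> Hom T Y Z\<rbrakk> \<Longrightarrow>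
        Comp T (Add T g g') f = Add T (Comp T g f) (Comp T g' f)"
    and zero_object_exists: "\<exists>N. zero_object T N"
    and biproduct_exists: "\<lbrakk>X \<in> Obj T; Y \<in> Obj T\<rbrakk> \<Longrightarrow>
        \<exists>P i1 i2 p1 p2. biproduct T X Y P i1 i2 p1 p2"

text \<open>
  The translation functor is an additive autoequivalence (fully faithful and essentially surjective);
  strict automorphisms are a special case.
\<close>

locale category_with_translation = additive_category +
  assumes shift_obj: "X \<in> Obj T \<Longrightarrow> ShiftObj T X \<in> Obj T"
    and shift_ident: "X \<in> Obj T \<Longrightarrow> ShiftArr T (Ident T X) = Ident T (ShiftObj T X)"
    and shift_comp: "\<lbrakk>f \<in> Hom T X Y; g \<in> Hom T Y Z\<rbrakk> \<Longrightarrow>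
        ShiftArr T (Comp T g f) = Comp T (ShiftArr T g) (ShiftArr T f)"
    and shift_add: "\<lbrakk>f \<in> Hom T X Y; f' \<in> Hom T X Y\<rbrakk> \<Longrightarrow>
        ShiftArr T (Add T f f') = Add T (ShiftArr T f) (ShiftArr T f')"
    and shift_fully_faithful: "\<lbrakk>X \<in> Obj T; Y \<in> Obj T\<rbrakk> \<Longrightarrow>
        bij_betw (ShiftArr T) (Hom T X Y) (Hom T (ShiftObj T X) (ShiftObj T Y))"
    and shift_ess_surj: "Y \<in> Obj T \<Longrightarrow> \<exists>X \<in> Obj T. isomorphic T (ShiftObj T X) Y"

definition candidate_triangle :: "('o, 'm) tcat \<Rightarrow> 'm \<Rightarrow> 'm \<Rightarrow> 'm \<Rightarrow> bool" where
  "candidate_triangle T f g h \<longleftrightarrow> f \<in> Arr T \<and> g \<in> Arr T \<and> h \<in> Arr T \<and>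
     Cod T f = Dom T g \<and> Cod T g = Dom T h \<and> Cod T h = ShiftObj T (Dom T f)"

text \<open>A morphism (a, b, c) from the triangle (f, g, h) to the triangle (f', g', h').\<close>

definition triangle_morphism ::
  "('o, 'm) tcat \<Rightarrow> 'm \<times> 'm \<times> 'm \<Rightarrow> 'm \<times> 'm \<times> 'm \<Rightarrow> 'm \<Rightarrow> 'm \<Rightarrow> 'm \<Rightarrow> bool" where
  "triangle_morphism T = (\<lambda>(f, g, h) (f', g', h') a b c.
     a \<in> Hom T (Dom T f) (Dom T f') \<and> b \<in> Hom T (Dom T g) (Dom T g') \<and>
     c \<in> Hom T (Dom T h) (Dom T h') \<and>
     Comp T b f = Comp T f' a \<and> Comp T c g = Comp T g' b \<and>
     Comp T (ShiftArr T a) h = Comp T h' c)"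

locale triangulated_category = category_with_translation +
  assumes tri_candidate: "(f, g, h) \<in> Tri T \<Longrightarrow> candidate_triangle T f g h"
    and TR1_iso: "\<lbrakk>(f, g, h) \<in> Tri T; candidate_triangle T f' g' h';
        triangle_morphism T (f, g, h) (f', g', h') a b c; is_iso T a; is_iso T b; is_iso T c\<rbrakk> \<Longrightarrow>
        (f', g', h') \<in> Tri T"
    and TR1_ident: "\<lbrakk>X \<in> Obj T; zero_object T N\<rbrakk> \<Longrightarrow>
        (Ident T X, ZeroArr T X N, ZeroArr T N (ShiftObj T X)) \<in> Tri T"
    and TR1_cone: "f \<in> Arr T \<Longrightarrow> \<exists>g h. (f, g, h) \<in> Tri T"
    and TR2: "candidate_triangle T f g h \<Longrightarrow>
        (f, g, h) \<in> Tri T \<longleftrightarrow> (g, h, Neg T (ShiftArr T f)) \<in> Tri T"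
    and TR3: "\<lbrakk>(f, g, h) \<in> Tri T; (f', g', h') \<in> Tri T;
        a \<in> Hom T (Dom T f) (Dom T f'); b \<in> Hom T (Cod T f) (Cod T f');
        Comp T b f = Comp T f' a\<rbrakk> \<Longrightarrow>
        \<exists>c. triangle_morphism T (f, g, h) (f', g', h') a b c"
    and TR4: "\<lbrakk>u \<in> Hom T X Y; v \<in> Hom T Y Z;
        (u, i, i') \<in> Tri T; (v, j, j') \<in> Tri T; (Comp T v u, k, k') \<in> Tri T\<rbrakk> \<Longrightarrow>
        \<exists>a \<in> Hom T (Cod T i) (Cod T k). \<exists>b \<in> Hom T (Cod T k) (Cod T j).
          (a, b, Comp T (ShiftArr T i) j') \<in> Tri T \<and>
          Comp T a i = Comp T k v \<and> Comp T k' a = i' \<and>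
          Comp T b k = j \<and> Comp T j' b = Comp T (ShiftArr T u) k'"

definition full_subcategory :: "('o, 'm) tcat \<Rightarrow> 'o set \<Rightarrow> ('o, 'm) tcat" where
  "full_subcategory T S = T\<lparr>Obj := S,
     Arr := {f \<in> Arr T. Dom T f \<in> S \<and> Cod T f \<in> S},
     Tri := {(f, g, h) \<in> Tri T. Dom T f \<in> S \<and> Dom T g \<in> S \<and> Dom T h \<in> S \<and> Cod T h \<in> S}\<rparr>"

section \<open>t-structures\<close>

text \<open>
  A full subcategory is identified with its set of objects. For an integer n, the full subcategory
  shift_class T n A is the closure under isomorphism of Sigma^n A. No quasi-inverse of Sigma is
  chosen: one of nat n and nat (-n) is 0, so the condition below reads Sigma^n X isomorphic to Y for
  n >= 0, and X isomorphic to Sigma^(-n) Y for n <= 0.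
\<close>

definition shift_class :: "('o, 'm) tcat \<Rightarrow> int \<Rightarrow> 'o set \<Rightarrow> 'o set" where
  "shift_class T n A = {Y \<in> Obj T. \<exists>X \<in> A.
     isomorphic T ((ShiftObj T ^^ nat n) X) ((ShiftObj T ^^ nat (- n)) Y)}"

definition strictly_full :: "('o, 'm) tcat \<Rightarrow> 'o set \<Rightarrow> bool" where
  "strictly_full T A \<longleftrightarrow> A \<subseteq> Obj T \<and> (\<forall>X \<in> A. \<forall>Y \<in> Obj T. isomorphic T X Y \<longrightarrow> Y \<in> A)"

text \<open>In (T3), the object W plays the role of the desuspension of an object Y of snd U.\<close>

locale t_structure = triangulated_category T for T :: "('o, 'm) tcat" +
  fixes U :: "'o set \<times> 'o set"
  assumes le_strictly_full: "strictly_full T (fst U)"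
    and ge_strictly_full: "strictly_full T (snd U)"
    and T1_le: "shift_class T 1 (fst U) \<subseteq> fst U"
    and T1_ge: "shift_class T (- 1) (snd U) \<subseteq> snd U"
    and T2: "\<lbrakk>X \<in> fst U; Y \<in> shift_class T (- 1) (snd U)\<rbrakk> \<Longrightarrow> Hom T X Y = {ZeroArr T X Y}"
    and T3: "Z \<in> Obj T \<Longrightarrow> \<exists>X \<in> fst U. \<exists>W \<in> shift_class T (- 1) (snd U).
        \<exists>f \<in> Hom T X Z. \<exists>g \<in> Hom T Z W. \<exists>h \<in> Hom T W (ShiftObj T X). (f, g, h) \<in> Tri T"

definition t_le :: "('o, 'm) tcat \<Rightarrow> 'o set \<times> 'o set \<Rightarrow> int \<Rightarrow> 'o set" where
  "t_le T U n = shift_class T (- n) (fst U)"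

definition t_ge :: "('o, 'm) tcat \<Rightarrow> 'o set \<times> 'o set \<Rightarrow> int \<Rightarrow> 'o set" where
  "t_ge T U n = shift_class T (- n) (snd U)"

definition t_interval :: "('o, 'm) tcat \<Rightarrow> 'o set \<times> 'o set \<Rightarrow> int \<Rightarrow> int \<Rightarrow> 'o set" where
  "t_interval T U m n = t_ge T U m \<inter> t_le T U n"

definition t_bounded_objects :: "('o, 'm) tcat \<Rightarrow> 'o set \<times> 'o set \<Rightarrow> 'o set" where
  "t_bounded_objects T U = (\<Union>n::nat. t_interval T U (- int n) (int n))"

definition bounded_t_structure :: "('o, 'm) tcat \<Rightarrow> 'o set \<times> 'o set \<Rightarrow> bool" where
  "bounded_t_structure T U \<longleftrightarrow> t_structure T U \<and>
     (\<Union>n. t_le T U n) = Obj T \<and> (\<Union>n. t_ge T U n) = Obj T"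

definition t_restrict :: "'o set \<Rightarrow> 'o set \<times> 'o set \<Rightarrow> 'o set \<times> 'o set" where
  "t_restrict S V = (S \<inter> fst V, S \<inter> snd V)"

text \<open>The infimum of the empty set is \<open>\<infinity>\<close>; otherwise it is a minimum.\<close>

definition t_distance ::
  "('o, 'm) tcat \<Rightarrow> 'o set \<times> 'o set \<Rightarrow> 'o set \<times> 'o set \<Rightarrow> enat" where
  "t_distance T U V =
     Inf {enat d | d. \<exists>m. t_le T V m \<subseteq> t_le T U 0 \<and> t_le T U 0 \<subseteq> t_le T V (m + int d)}"

end

theory Submission
  imports Defs
begin

text \<open>
  A t-structure is determined by its aisle, that is, its objects of degree at most 0: the other half
  is an orthogonal (\<open>t_structure_iff\<close>). So it suffices to compare aisles B of T that are commensurable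
  with the aisle A of U, meaning that powers of \<Sigma> move A and B into each other, with such aisles
  of the bounded part S of A. Commensurable aisles have the same bounded part
  (\<open>bounded_part_eq_if_commensurable\<close>), which is a triangulated subcategory, and truncations of
  bounded objects are bounded; hence every aisle commensurable with A restricts to an aisle of S, and
  orthogonals are compatible with restriction (\<open>aisle_restrict\<close>, \<open>coaisle_restrict\<close>).

  For the inverse, enclose everything between a suspension L and a desuspension H of A. Since L is
  contained in B and objects right orthogonal to H are right orthogonal to B, the aisle B only makes
  a difference on the part of an object between its truncations with respect to L and H, and that
  part is bounded. Precisely, an object is in B iff it is an extension
  P -> X -> Q with P in L and Q a bounded object of B (\<open>aisle_eq_glued\<close>), so B is determined by
  its bounded objects. Conversely, an aisle of S that lies between the bounded parts of L and H defines
  an aisle of T by the same formula (\<open>aisle_glued_aisle\<close>): the truncation of Z is obtained from the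
  truncations with respect to L and H and from that of the bounded part in between, reassembled by two
  octahedra.
\<close>

text \<open>
  The argument is carried out with objects: it only matters that some exact triangle connects three
  objects, and that some Hom group vanishes.
\<close>

definition distinguished :: "('o, 'm) tcat \<Rightarrow> 'o \<Rightarrow> 'o \<Rightarrow> 'o \<Rightarrow> bool" where
  "distinguished T X Y Z \<longleftrightarrow>
     (\<exists>f \<in> Hom T X Y. \<exists>g \<in> Hom T Y Z. \<exists>h \<in> Hom T Z (ShiftObj T X). (f, g, h) \<in> Tri T)"

definition orthogonal :: "('o, 'm) tcat \<Rightarrow> 'o \<Rightarrow> 'o \<Rightarrow> bool" where
  "orthogonal T X Y \<longleftrightarrow> Hom T X Y \<subseteq> {ZeroArr T X Y}"

section \<open>Categories, additive categories and translation functors\<close>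

context category
begin

lemma hom_dom_cod: "f \<in> Hom T X Y \<Longrightarrow> f \<in> Arr T \<and> Dom T f = X \<and> Cod T f = Y"
  by (simp add: Hom_def)

lemma hom_obj: "f \<in> Hom T X Y \<Longrightarrow> X \<in> Obj T \<and> Y \<in> Obj T"
  using arr_obj by (auto simp: Hom_def)

lemma is_iso_iff:
  assumes "f \<in> Hom T X Y"
  shows "is_iso T f \<longleftrightarrow> (\<exists>g \<in> Hom T Y X. Comp T g f = Ident T X \<and> Comp T f g = Ident T Y)"
  using assms by (auto simp: is_iso_def Hom_def)

lemma isomorphic_iff:
  "isomorphic T X Y \<longleftrightarrow> (\<exists>f \<in> Hom T X Y. \<exists>g \<in> Hom T Y X.
     Comp T g f = Ident T X \<and> Comp T f g = Ident T Y)"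
  unfolding isomorphic_def using is_iso_iff by blast

lemma is_iso_ident: "X \<in> Obj T \<Longrightarrow> is_iso T (Ident T X)"
  using is_iso_iff[OF ident_hom] ident_hom comp_ident_left by blast

lemma isomorphic_refl: "X \<in> Obj T \<Longrightarrow> isomorphic T X X"
  unfolding isomorphic_def using ident_hom is_iso_ident by blast

lemma isomorphic_sym: "isomorphic T X Y \<Longrightarrow> isomorphic T Y X"
  unfolding isomorphic_iff by blast

lemma isomorphic_obj: "isomorphic T X Y \<Longrightarrow> X \<in> Obj T \<and> Y \<in> Obj T"
  unfolding isomorphic_def using hom_obj by blast

lemma comp_inverse_pairs:
  assumes f: "f \<in> Hom T X Y" "f' \<in> Hom T Y X" "Comp T f' f = Ident T X"
    and g: "g \<in> Hom T Y Z" "g' \<in> Hom T Z Y" "Comp T g' g = Ident T Y"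
  shows "Comp T (Comp T f' g') (Comp T g f) = Ident T X"
proof -
  have "Comp T (Comp T f' g') (Comp T g f) = Comp T f' (Comp T g' (Comp T g f))"
    using comp_assoc[OF comp_hom[OF f(1) g(1)] g(2) f(2)] by simp
  also have "Comp T g' (Comp T g f) = f"
    using comp_assoc[OF f(1) g(1) g(2)] comp_ident_left[OF f(1)] g(3) by simp
  finally show ?thesis using f(3) by simp
qed

lemma isomorphic_trans:
  assumes "isomorphic T X Y" "isomorphic T Y Z"
  shows "isomorphic T X Z"
proof -
  obtain f f' where f: "f \<in> Hom T X Y" "f' \<in> Hom T Y X"
    "Comp T f' f = Ident T X" "Comp T f f' = Ident T Y"
    using assms(1) unfolding isomorphic_iff by blast
  obtain g g' where g: "g \<in> Hom T Y Z" "g' \<in> Hom T Z Y"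
    "Comp T g' g = Ident T Y" "Comp T g g' = Ident T Z"
    using assms(2) unfolding isomorphic_iff by blast
  show ?thesis
    unfolding isomorphic_iff
    using comp_hom[OF f(1) g(1)] comp_hom[OF g(2) f(2)]
      comp_inverse_pairs[OF f(1-3) g(1-3)] comp_inverse_pairs[OF g(2,1,4) f(2,1,4)] by blast
qed

lemma isomorphic_if_one_sided_inverses:
  assumes f: "f \<in> Hom T X Y"
    and u: "u \<in> Hom T Y X" "Comp T f u = Ident T Y"
    and w: "w \<in> Hom T Y X" "Comp T w f = Ident T X"
  shows "isomorphic T X Y"
proof -
  have "w = Comp T w (Comp T f u)"
    using u w comp_ident_right by simp
  also have "\<dots> = u"
    using comp_assoc[OF u(1) f w(1)] w(2) comp_ident_left[OF u(1)] by simp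
  finally show ?thesis
    unfolding isomorphic_iff using f u w by blast
qed

lemma strictly_full_iso:
  "\<lbrakk>strictly_full T A; X \<in> A; isomorphic T X Y\<rbrakk> \<Longrightarrow> Y \<in> A"
  unfolding strictly_full_def using isomorphic_obj by blast

lemma strictly_full_obj: "\<lbrakk>strictly_full T A; X \<in> A\<rbrakk> \<Longrightarrow> X \<in> Obj T"
  unfolding strictly_full_def by blast

end

context additive_category
begin

lemma zero_hom: "\<lbrakk>X \<in> Obj T; Y \<in> Obj T\<rbrakk> \<Longrightarrow> ZeroArr T X Y \<in> Hom T X Y"
  using monoid.one_closed[of "HomGroup T X Y"] hom_group[of X Y]
  by (simp add: HomGroup_def comm_group_def group_def)

lemma add_zero:
  assumes "f \<in> Hom T X Y"
  shows "Add T f (ZeroArr T X Y) = f" "Add T (ZeroArr T X Y) f = f"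
proof -
  interpret comm_group "HomGroup T X Y"
    using hom_group hom_obj[OF assms] by blast
  show "Add T f (ZeroArr T X Y) = f" "Add T (ZeroArr T X Y) f = f"
    using r_one[of f] l_one[of f] assms by (simp_all add: HomGroup_def)
qed

lemma add_idem_zero:
  assumes "f \<in> Hom T X Y" "Add T f f = f"
  shows "f = ZeroArr T X Y"
proof -
  interpret comm_group "HomGroup T X Y"
    using hom_group hom_obj[OF assms(1)] by blast
  show ?thesis
    using r_cancel_one[of f f] assms by (simp add: HomGroup_def)
qed

lemma comp_zero_right:
  assumes "W \<in> Obj T" "g \<in> Hom T X Y"
  shows "Comp T g (ZeroArr T W X) = ZeroArr T W Y"
proof -
  have z: "ZeroArr T W X \<in> Hom T W X"
    using zero_hom assms hom_obj by blast
  show ?thesis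
    using add_idem_zero[OF comp_hom[OF z assms(2)]] comp_add_right[OF z z assms(2)]
      add_zero[OF z] by simp
qed

lemma comp_zero_left:
  assumes "Z \<in> Obj T" "f \<in> Hom T X Y"
  shows "Comp T (ZeroArr T Y Z) f = ZeroArr T X Z"
proof -
  have z: "ZeroArr T Y Z \<in> Hom T Y Z"
    using zero_hom assms hom_obj by blast
  show ?thesis
    using add_idem_zero[OF comp_hom[OF assms(2) z]] comp_add_left[OF assms(2) z z]
      add_zero[OF z] by simp
qed

lemma orthogonal_iff:
  assumes "X \<in> Obj T" "Y \<in> Obj T"
  shows "orthogonal T X Y \<longleftrightarrow> Hom T X Y = {ZeroArr T X Y}"
  using zero_hom[OF assms] by (auto simp: orthogonal_def)

lemma orthogonalD: "\<lbrakk>orthogonal T X Y; f \<in> Hom T X Y\<rbrakk> \<Longrightarrow> f = ZeroArr T X Y"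
  by (auto simp: orthogonal_def)

lemma zero_object_iff: "zero_object T N \<longleftrightarrow> N \<in> Obj T \<and> orthogonal T N N"
proof
  assume "zero_object T N"
  then show "N \<in> Obj T \<and> orthogonal T N N"
    unfolding zero_object_def orthogonal_def using zero_hom by blast
next
  assume N: "N \<in> Obj T \<and> orthogonal T N N"
  then have id: "Ident T N = ZeroArr T N N"
    using orthogonalD ident_hom by blast
  show "zero_object T N"
    unfolding zero_object_def
  proof (intro conjI ballI)
    show "N \<in> Obj T" using N by blast
  next
    fix X assume X: "X \<in> Obj T"
    have "f = ZeroArr T X N" if "f \<in> Hom T X N" for f
      using comp_ident_left[OF that] comp_zero_left[OF _ that] N id by simp
    then show "\<exists>!f. f \<in> Hom T X N" using zero_hom X N by blast
    have "f = ZeroArr T N X" if "f \<in> Hom T N X" for f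
      using comp_ident_right[OF that] comp_zero_right[OF _ that] N id by simp
    then show "\<exists>!f. f \<in> Hom T N X" using zero_hom X N by blast
  qed
qed

lemma orthogonal_zero_object:
  assumes "zero_object T N" "X \<in> Obj T"
  shows "orthogonal T X N" "orthogonal T N X"
  using assms zero_hom unfolding zero_object_def orthogonal_def by blast+

lemma orthogonal_iso_left:
  assumes "orthogonal T X Y" "isomorphic T X X'"
  shows "orthogonal T X' Y"
  unfolding orthogonal_def
proof (intro subsetI, simp)
  fix v assume v: "v \<in> Hom T X' Y"
  obtain f g where fg: "f \<in> Hom T X X'" "g \<in> Hom T X' X" "Comp T f g = Ident T X'"
    using assms(2) unfolding isomorphic_iff by blast
  have "Comp T v f = ZeroArr T X Y"
    using orthogonalD[OF assms(1)] comp_hom[OF fg(1) v] by blast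
  then have "Comp T v (Comp T f g) = ZeroArr T X' Y"
    using comp_assoc[OF fg(2,1) v] comp_zero_left[OF _ fg(2)] hom_obj[OF v] by simp
  then show "v = ZeroArr T X' Y"
    using fg(3) comp_ident_right[OF v] by simp
qed

lemma orthogonal_iso_right:
  assumes "orthogonal T X Y" "isomorphic T Y Y'"
  shows "orthogonal T X Y'"
  unfolding orthogonal_def
proof (intro subsetI, simp)
  fix v assume v: "v \<in> Hom T X Y'"
  obtain f g where fg: "f \<in> Hom T Y Y'" "g \<in> Hom T Y' Y" "Comp T f g = Ident T Y'"
    using assms(2) unfolding isomorphic_iff by blast
  have "Comp T g v = ZeroArr T X Y"
    using orthogonalD[OF assms(1)] comp_hom[OF v fg(2)] by blast
  then have "Comp T (Comp T f g) v = ZeroArr T X Y'"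
    using comp_assoc[OF v fg(2,1)] comp_zero_right[OF _ fg(1)] hom_obj[OF v] by simp
  then show "v = ZeroArr T X Y'"
    using fg(3) comp_ident_left[OF v] by simp
qed

lemma Neg_hom: "f \<in> Hom T X Y \<Longrightarrow> Neg T f \<in> Hom T X Y"
  using group.inv_closed[of "HomGroup T X Y" f] hom_group[of X Y] hom_obj[of f X Y]
  by (simp add: Neg_def HomGroup_def comm_group_def Hom_def)

lemma Neg_Neg: 
  assumes "f \<in> Hom T X Y"
  shows "Neg T (Neg T f) = f"
proof -
  interpret comm_group "HomGroup T X Y"
    using hom_group hom_obj[OF assms(1)] by blast
  show ?thesis
    using inv_inv[of f] hom_dom_cod[OF assms] hom_dom_cod[OF Neg_hom[OF assms]] assms
    by (simp add: Neg_def HomGroup_def)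
qed

lemma Neg_unique:
  assumes "f \<in> Hom T X Y" "g \<in> Hom T X Y" "Add T f g = ZeroArr T X Y"
  shows "Neg T g = f"
proof -
  interpret comm_group "HomGroup T X Y"
    using hom_group hom_obj[OF assms(1)] by blast
  show ?thesis
    using inv_equality[of f g] hom_dom_cod[OF assms(2)] assms
    by (simp add: Neg_def HomGroup_def)
qed

lemma add_Neg:
  assumes "f \<in> Hom T X Y"
  shows "Add T (Neg T f) f = ZeroArr T X Y"
proof -
  interpret comm_group "HomGroup T X Y"
    using hom_group hom_obj[OF assms(1)] by blast
  show ?thesis
    using l_inv[of f] hom_dom_cod[OF assms] assms by (simp add: Neg_def HomGroup_def)
qed

lemma Neg_zero: 
  assumes "X \<in> Obj T" "Y \<in> Obj T"
  shows "Neg T (ZeroArr T X Y) = ZeroArr T X Y"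
  using Neg_unique zero_hom[OF assms] add_zero by blast

lemma comp_Neg_right:
  assumes "f \<in> Hom T X Y" "g \<in> Hom T Y Z"
  shows "Comp T g (Neg T f) = Neg T (Comp T g f)"
proof -
  have "Add T (Comp T g (Neg T f)) (Comp T g f) = ZeroArr T X Z"
    using comp_add_right[OF Neg_hom[OF assms(1)] assms] add_Neg[OF assms(1)]
      comp_zero_right[OF _ assms(2)] hom_obj[OF assms(1)] by simp
  from Neg_unique[OF comp_hom[OF Neg_hom[OF assms(1)] assms(2)] comp_hom[OF assms] this]
  show ?thesis by simp
qed

lemma comp_Neg_left:
  assumes "f \<in> Hom T X Y" "g \<in> Hom T Y Z"
  shows "Comp T (Neg T g) f = Neg T (Comp T g f)"
proof -
  have "Add T (Comp T (Neg T g) f) (Comp T g f) = ZeroArr T X Z"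
    using comp_add_left[OF assms(1) Neg_hom[OF assms(2)] assms(2)] add_Neg[OF assms(2)]
      comp_zero_left[OF _ assms(1)] hom_obj[OF assms(2)] by simp
  from Neg_unique[OF comp_hom[OF assms(1) Neg_hom[OF assms(2)]] comp_hom[OF assms] this]
  show ?thesis by simp
qed

end

context category_with_translation
begin

lemma shift_hom: "f \<in> Hom T X Y \<Longrightarrow> ShiftArr T f \<in> Hom T (ShiftObj T X) (ShiftObj T Y)"
  by (rule bij_betw_apply[OF shift_fully_faithful]) (simp_all add: hom_obj)

lemma shift_full:
  assumes "X \<in> Obj T" "Y \<in> Obj T" "g \<in> Hom T (ShiftObj T X) (ShiftObj T Y)"
  obtains f where "f \<in> Hom T X Y" "ShiftArr T f = g"
proof -
  have "g \<in> ShiftArr T ` Hom T X Y"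
    using bij_betw_imp_surj_on[OF shift_fully_faithful[OF assms(1,2)]] assms(3) by simp
  then show thesis using that by auto
qed

lemma shift_faithful:
  assumes "f \<in> Hom T X Y" "f' \<in> Hom T X Y" "ShiftArr T f = ShiftArr T f'"
  shows "f = f'"
proof (rule inj_onD[OF bij_betw_imp_inj_on assms(3,1,2)])
  show "bij_betw (ShiftArr T) (Hom T X Y) (Hom T (ShiftObj T X) (ShiftObj T Y))"
    using shift_fully_faithful hom_obj[OF assms(1)] by simp
qed

lemma shift_zero:
  assumes "X \<in> Obj T" "Y \<in> Obj T"
  shows "ShiftArr T (ZeroArr T X Y) = ZeroArr T (ShiftObj T X) (ShiftObj T Y)"
proof -
  note z = zero_hom[OF assms]
  show ?thesis
    using add_idem_zero[OF shift_hom[OF z]] shift_add[OF z z] add_zero[OF z] by simp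
qed

lemma isomorphic_shift:
  assumes "isomorphic T X Y"
  shows "isomorphic T (ShiftObj T X) (ShiftObj T Y)"
proof -
  obtain f g where fg: "f \<in> Hom T X Y" "g \<in> Hom T Y X"
    "Comp T g f = Ident T X" "Comp T f g = Ident T Y"
    using assms unfolding isomorphic_iff by blast
  show ?thesis
    unfolding isomorphic_iff
  proof (intro bexI conjI)
    show "Comp T (ShiftArr T g) (ShiftArr T f) = Ident T (ShiftObj T X)"
      using shift_comp[OF fg(1,2)] fg(3) shift_ident hom_obj[OF fg(1)] by simp
    show "Comp T (ShiftArr T f) (ShiftArr T g) = Ident T (ShiftObj T Y)"
      using shift_comp[OF fg(2,1)] fg(4) shift_ident hom_obj[OF fg(1)] by simp
  qed (use shift_hom fg in auto)
qed

lemma orthogonal_shift_iff: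
  assumes "X \<in> Obj T" "Y \<in> Obj T"
  shows "orthogonal T (ShiftObj T X) (ShiftObj T Y) \<longleftrightarrow> orthogonal T X Y"
proof
  assume o: "orthogonal T (ShiftObj T X) (ShiftObj T Y)"
  have "f = ZeroArr T X Y" if f: "f \<in> Hom T X Y" for f
    using shift_faithful[OF f zero_hom[OF assms]] shift_zero[OF assms]
      orthogonalD[OF o shift_hom[OF f]] by simp
  then show "orthogonal T X Y" by (auto simp: orthogonal_def)
next
  assume o: "orthogonal T X Y"
  have "g = ZeroArr T (ShiftObj T X) (ShiftObj T Y)"
    if g: "g \<in> Hom T (ShiftObj T X) (ShiftObj T Y)" for g
  proof -
    obtain f where f: "f \<in> Hom T X Y" "ShiftArr T f = g"
      using shift_full[OF assms g] .
    then show ?thesis using orthogonalD[OF o f(1)] shift_zero[OF assms] by simp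
  qed
  then show "orthogonal T (ShiftObj T X) (ShiftObj T Y)" by (auto simp: orthogonal_def)
qed

lemma zero_object_shift: "zero_object T N \<Longrightarrow> zero_object T (ShiftObj T N)"
  by (simp add: zero_object_iff orthogonal_shift_iff shift_obj)

lemma shift_pow_obj: "X \<in> Obj T \<Longrightarrow> (ShiftObj T ^^ n) X \<in> Obj T"
  by (induction n) (auto simp: shift_obj)

lemma isomorphic_shift_pow:
  "isomorphic T X Y \<Longrightarrow> isomorphic T ((ShiftObj T ^^ n) X) ((ShiftObj T ^^ n) Y)"
  by (induction n) (auto simp: isomorphic_shift)

lemma orthogonal_shift_pow_iff:
  assumes "X \<in> Obj T" "Y \<in> Obj T"
  shows "orthogonal T ((ShiftObj T ^^ n) X) ((ShiftObj T ^^ n) Y) \<longleftrightarrow> orthogonal T X Y"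
  by (induction n) (auto simp: orthogonal_shift_iff shift_pow_obj assms)

lemma shift_pow_ess_surj:
  "Y \<in> Obj T \<Longrightarrow> \<exists>X \<in> Obj T. isomorphic T ((ShiftObj T ^^ n) X) Y"
proof (induction n arbitrary: Y)
  case 0
  then show ?case using isomorphic_refl by auto
next
  case (Suc n)
  obtain W where W: "W \<in> Obj T" "isomorphic T (ShiftObj T W) Y"
    using shift_ess_surj[OF Suc.prems] by blast
  obtain X where X: "X \<in> Obj T" "isomorphic T ((ShiftObj T ^^ n) X) W"
    using Suc.IH[OF W(1)] by blast
  then show ?case
    using isomorphic_trans[OF isomorphic_shift[OF X(2)] W(2)] by auto
qed

end

section \<open>Calculus of exact triangles\<close>

context triangulated_category
begin

lemma tri_homs:
  assumes "(f, g, h) \<in> Tri T" "f \<in> Hom T X Y" "Cod T g = Z"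
  shows "g \<in> Hom T Y Z" "h \<in> Hom T Z (ShiftObj T X)"
  using tri_candidate[OF assms(1)] assms(2,3) by (auto simp: candidate_triangle_def Hom_def)

lemma candidate_triangleI:
  "\<lbrakk>f \<in> Hom T X Y; g \<in> Hom T Y Z; h \<in> Hom T Z (ShiftObj T X)\<rbrakk> \<Longrightarrow> candidate_triangle T f g h"
  by (auto simp: candidate_triangle_def Hom_def)

lemma tri_rotate:
  assumes "f \<in> Hom T X Y" "g \<in> Hom T Y Z" "h \<in> Hom T Z (ShiftObj T X)"
  shows "(f, g, h) \<in> Tri T \<longleftrightarrow> (g, h, Neg T (ShiftArr T f)) \<in> Tri T"
  using TR2[OF candidate_triangleI[OF assms]] .

lemma distinguished_rotate:
  assumes "distinguished T X Y Z"
  shows "distinguished T Y Z (ShiftObj T X)"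
proof -
  obtain f g h where t: "f \<in> Hom T X Y" "g \<in> Hom T Y Z" "h \<in> Hom T Z (ShiftObj T X)"
      "(f, g, h) \<in> Tri T"
    using assms unfolding distinguished_def by auto
  show ?thesis
    unfolding distinguished_def
    using t tri_rotate[OF t(1-3)] Neg_hom[OF shift_hom[OF t(1)]] by auto
qed

lemma distinguished_obj:
  "distinguished T X Y Z \<Longrightarrow> X \<in> Obj T \<and> Y \<in> Obj T \<and> Z \<in> Obj T"
  unfolding distinguished_def by (auto dest: hom_obj)

text \<open>
  (TR2) is an equivalence, but going back it needs an arrow X -> Y whose translate is the negative of
  the given one; fullness of the translation functor provides it. The first object is only determined
  up to isomorphism by its translate, so it has to be given.
\<close>

lemma distinguished_unrotate:
  assumes "distinguished T Y Z (ShiftObj T X)" "X \<in> Obj T"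
  shows "distinguished T X Y Z"
proof -
  obtain g h k where t: "g \<in> Hom T Y Z" "h \<in> Hom T Z (ShiftObj T X)"
      "k \<in> Hom T (ShiftObj T X) (ShiftObj T Y)" "(g, h, k) \<in> Tri T"
    using assms unfolding distinguished_def by auto
  obtain f where f: "f \<in> Hom T X Y" "ShiftArr T f = Neg T k"
    using shift_full[OF assms(2) _ Neg_hom[OF t(3)]] hom_obj[OF t(1)] by auto
  have "(f, g, h) \<in> Tri T"
    using tri_rotate[OF f(1) t(1,2)] t(4) f(2) Neg_Neg[OF t(3)] by simp
  then show ?thesis
    unfolding distinguished_def using f(1) t(1,2) by auto
qed

lemma distinguished_shift:
  "distinguished T X Y Z \<Longrightarrow> distinguished T (ShiftObj T X) (ShiftObj T Y) (ShiftObj T Z)"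
  by (intro distinguished_rotate)

lemma distinguished_unshift:
  assumes "distinguished T (ShiftObj T X) (ShiftObj T Y) (ShiftObj T Z)"
    "X \<in> Obj T" "Y \<in> Obj T" "Z \<in> Obj T"
  shows "distinguished T X Y Z"
proof -
  have "distinguished T Z (ShiftObj T X) (ShiftObj T Y)"
    by (rule distinguished_unrotate[OF assms(1,4)])
  then have "distinguished T Y Z (ShiftObj T X)"
    by (rule distinguished_unrotate[OF _ assms(3)])
  then show ?thesis
    by (rule distinguished_unrotate[OF _ assms(2)])
qed

lemma distinguished_shift_pow:
  "distinguished T X Y Z \<Longrightarrow>
   distinguished T ((ShiftObj T ^^ n) X) ((ShiftObj T ^^ n) Y) ((ShiftObj T ^^ n) Z)"
  by (induction n) (auto intro: distinguished_shift)

lemma distinguished_unshift_pow: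
  assumes "X \<in> Obj T" "Y \<in> Obj T" "Z \<in> Obj T"
  shows "distinguished T ((ShiftObj T ^^ n) X) ((ShiftObj T ^^ n) Y) ((ShiftObj T ^^ n) Z) \<Longrightarrow>
   distinguished T X Y Z"
proof (induction n)
  case (Suc n)
  then show ?case
    using distinguished_unshift shift_pow_obj assms by simp
qed simp

text \<open>
  Transport along an isomorphism of the first object is (TR1) with identities elsewhere. The other
  two positions follow by rotation.
\<close>

lemma distinguished_iso_left:
  assumes "distinguished T X Y Z" "isomorphic T X X'"
  shows "distinguished T X' Y Z"
proof -
  obtain f g h where t: "f \<in> Hom T X Y" "g \<in> Hom T Y Z" "h \<in> Hom T Z (ShiftObj T X)"
      "(f, g, h) \<in> Tri T"
    using assms(1) unfolding distinguished_def by auto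
  obtain a a' where a: "a \<in> Hom T X X'" "a' \<in> Hom T X' X"
      "Comp T a' a = Ident T X" "Comp T a a' = Ident T X'"
    using assms(2) unfolding isomorphic_iff by auto
  define f' where "f' = Comp T f a'"
  define h' where "h' = Comp T (ShiftArr T a) h"
  have f': "f' \<in> Hom T X' Y" and h': "h' \<in> Hom T Z (ShiftObj T X')"
    unfolding f'_def h'_def using comp_hom t a shift_hom by auto
  have Y: "Y \<in> Obj T" and Z: "Z \<in> Obj T"
    using hom_obj[OF t(2)] by auto
  have "(f', g, h') \<in> Tri T"
  proof (rule TR1_iso[OF t(4) candidate_triangleI[OF f' t(2) h']])
    have "Comp T (Ident T Y) f = Comp T f' a"
      using comp_assoc[OF a(1,2) t(1)] a(3) comp_ident_left[OF t(1)] comp_ident_right[OF t(1)]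
      by (simp add: f'_def)
    then show "triangle_morphism T (f, g, h) (f', g, h') a (Ident T Y) (Ident T Z)"
      unfolding triangle_morphism_def
      using t(1-3) f' h' a(1) ident_hom[OF Y] ident_hom[OF Z] comp_ident_left[OF t(2)]
        comp_ident_right[OF t(2)] comp_ident_right[OF h']
      by (auto simp: h'_def hom_dom_cod)
    show "is_iso T a" using is_iso_iff[OF a(1)] a by auto
  qed (simp_all add: is_iso_ident Y Z)
  then show ?thesis
    unfolding distinguished_def using f' t(2) h' by auto
qed

lemma distinguished_iso_middle:
  assumes "distinguished T X Y Z" "isomorphic T Y Y'"
  shows "distinguished T X Y' Z"
  using distinguished_unrotate[OF distinguished_iso_left[OF distinguished_rotate[OF assms(1)] assms(2)]]
    distinguished_obj[OF assms(1)] by simp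

lemma distinguished_iso_right:
  assumes "distinguished T X Y Z" "isomorphic T Z Z'"
  shows "distinguished T X Y Z'"
  using distinguished_unrotate[OF distinguished_iso_middle[OF distinguished_rotate[OF assms(1)] assms(2)]]
    distinguished_obj[OF assms(1)] by simp

lemma distinguished_ident:
  assumes "X \<in> Obj T" "zero_object T N"
  shows "distinguished T X X N"
proof -
  have N: "N \<in> Obj T" using assms(2) by (simp add: zero_object_def)
  show ?thesis
    unfolding distinguished_def
    using TR1_ident[OF assms] ident_hom[OF assms(1)] zero_hom[OF assms(1) N]
      zero_hom[OF N shift_obj[OF assms(1)]] by auto
qed

lemma distinguished_zero_left:
  assumes "X \<in> Obj T" "zero_object T N"
  shows "distinguished T N X X"
  using distinguished_unrotate[OF distinguished_ident[OF assms(1) zero_object_shift[OF assms(2)]]]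
    assms(2) by (simp add: zero_object_def)

lemma octahedron:
  assumes "distinguished T X Y C" "distinguished T Y Z D"
  obtains W where "distinguished T X Z W" "distinguished T C W D"
proof -
  obtain u i i' where u: "u \<in> Hom T X Y" "i \<in> Hom T Y C" "i' \<in> Hom T C (ShiftObj T X)"
      "(u, i, i') \<in> Tri T"
    using assms(1) unfolding distinguished_def by auto
  obtain v j j' where v: "v \<in> Hom T Y Z" "j \<in> Hom T Z D" "j' \<in> Hom T D (ShiftObj T Y)"
      "(v, j, j') \<in> Tri T"
    using assms(2) unfolding distinguished_def by auto
  have vu: "Comp T v u \<in> Hom T X Z" using comp_hom[OF u(1) v(1)] .
  obtain k k' where k: "(Comp T v u, k, k') \<in> Tri T"
    using TR1_cone[of "Comp T v u"] hom_dom_cod[OF vu] by auto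
  obtain a b where ab: "a \<in> Hom T (Cod T i) (Cod T k)" "b \<in> Hom T (Cod T k) (Cod T j)"
      "(a, b, Comp T (ShiftArr T i) j') \<in> Tri T"
    using TR4[OF u(1) v(1) u(4) v(4) k] by auto
  have "distinguished T X Z (Cod T k)"
    unfolding distinguished_def using vu k tri_homs[OF k vu refl] by auto
  moreover have "distinguished T C (Cod T k) D"
    unfolding distinguished_def
    using ab hom_dom_cod[OF u(2)] hom_dom_cod[OF v(2)] comp_hom[OF v(3) shift_hom[OF u(2)]] by auto
  ultimately show thesis using that by simp
qed

lemma tri_comp_zero:
  assumes t: "f \<in> Hom T X Y" "g \<in> Hom T Y Z" "(f, g, h) \<in> Tri T"
  shows "Comp T g f = ZeroArr T X Z"
proof -
  obtain N where N: "zero_object T N" using zero_object_exists by auto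
  then have N': "N \<in> Obj T" by (simp add: zero_object_def)
  have X: "X \<in> Obj T" using hom_obj[OF t(1)] by simp
  have d: "Dom T f = X" "Cod T f = Y" "Dom T g = Y" "Cod T g = Z" "Dom T h = Z"
    using hom_dom_cod[OF t(1)] hom_dom_cod[OF t(2)] tri_homs(2)[OF t(3,1) refl]
      hom_dom_cod[of h] by auto
  have e: "Dom T (Ident T X) = X" "Cod T (Ident T X) = X" "Dom T (ZeroArr T X N) = X"
     "Dom T (ZeroArr T N (ShiftObj T X)) = N"
    using hom_dom_cod ident_hom[OF X] zero_hom[OF X N'] zero_hom[OF N' shift_obj[OF X]] by simp_all
  obtain c where "triangle_morphism T
      (Ident T X, ZeroArr T X N, ZeroArr T N (ShiftObj T X)) (f, g, h) (Ident T X) f c"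
    using TR3[OF TR1_ident[OF X N] t(3), of "Ident T X" f] ident_hom[OF X] t(1) d e by auto
  then have c: "c \<in> Hom T N Z" "Comp T c (ZeroArr T X N) = Comp T g f"
    by (auto simp: triangle_morphism_def d e)
  then show ?thesis using comp_zero_right[OF X c(1)] by simp
qed

text \<open>
  An arrow killed by g lifts along f. The zero composite is a square from the rotated triangle
  A -> 0 -> \<Sigma>A to the rotated triangle Y -> Z -> \<Sigma>X; (TR3) completes it with an arrow
  \<Sigma>A -> \<Sigma>X, and full faithfulness of \<Sigma> desuspends it.
\<close>

lemma weak_kernel:
  assumes t: "f \<in> Hom T X Y" "g \<in> Hom T Y Z" "(f, g, h) \<in> Tri T"
    and v: "v \<in> Hom T A Y" "Comp T g v = ZeroArr T A Z"
  obtains u where "u \<in> Hom T A X" "v = Comp T f u"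
proof -
  obtain N where N: "zero_object T N" using zero_object_exists by auto
  then have N': "N \<in> Obj T" by (simp add: zero_object_def)
  have A: "A \<in> Obj T" and X: "X \<in> Obj T" and Z: "Z \<in> Obj T"
    using hom_obj[OF v(1)] hom_obj[OF t(1)] hom_obj[OF t(2)] by auto
  have h: "h \<in> Hom T Z (ShiftObj T X)"
    using tri_homs(2)[OF t(3,1)] hom_dom_cod[OF t(2)] by simp
  note SA = shift_obj[OF A]
  note z1 = zero_hom[OF A N'] and z2 = zero_hom[OF N' SA]
  note i = ident_hom[OF A]
  let ?k = "Neg T (ShiftArr T (Ident T A))"
  have k: "?k \<in> Hom T (ShiftObj T A) (ShiftObj T A)"
    using Neg_hom[OF shift_hom[OF i]] .
  have r: "(ZeroArr T A N, ZeroArr T N (ShiftObj T A), ?k) \<in> Tri T"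
    using tri_rotate[OF i z1 z2] TR1_ident[OF A N] by simp
  have r': "(g, h, Neg T (ShiftArr T f)) \<in> Tri T"
    using tri_rotate[OF t(1,2) h] t(3) by simp
  note sf = shift_hom[OF t(1)]
  note d = hom_dom_cod[OF z1] hom_dom_cod[OF z2] hom_dom_cod[OF t(2)] hom_dom_cod[OF h]
    hom_dom_cod[OF k] hom_dom_cod[OF Neg_hom[OF sf]]
  have sq: "Comp T (ZeroArr T N Z) (ZeroArr T A N) = Comp T g v"
    using comp_zero_left[OF Z z1] v(2) by simp
  have "v \<in> Hom T (Dom T (ZeroArr T A N)) (Dom T g)"
    "ZeroArr T N Z \<in> Hom T (Cod T (ZeroArr T A N)) (Cod T g)"
    using v(1) zero_hom[OF N' Z] d by simp_all
  from TR3[OF r r' this sq] obtain c where "triangle_morphism T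
     (ZeroArr T A N, ZeroArr T N (ShiftObj T A), ?k) (g, h, Neg T (ShiftArr T f))
     v (ZeroArr T N Z) c" ..
  then have c: "c \<in> Hom T (ShiftObj T A) (ShiftObj T X)"
    "Comp T (ShiftArr T v) ?k = Comp T (Neg T (ShiftArr T f)) c"
    by (simp_all add: triangle_morphism_def d)
  obtain u where u: "u \<in> Hom T A X" "ShiftArr T u = c"
    using shift_full[OF A X c(1)] .
  have fu: "Comp T f u \<in> Hom T A Y" using comp_hom[OF u(1) t(1)] .
  have "Neg T (ShiftArr T v) = Comp T (ShiftArr T v) ?k"
    using comp_Neg_right[OF shift_hom[OF i] shift_hom[OF v(1)]] shift_ident[OF A]
      comp_ident_right[OF shift_hom[OF v(1)]] by simp
  also have "\<dots> = Neg T (ShiftArr T (Comp T f u))"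
    using c(2) comp_Neg_left[OF c(1) sf] shift_comp[OF u(1) t(1)] u(2) by simp
  finally have "ShiftArr T v = ShiftArr T (Comp T f u)"
    using Neg_Neg[OF shift_hom[OF v(1)]] Neg_Neg[OF shift_hom[OF fu]] by metis
  then show thesis
    using that u(1) shift_faithful[OF v(1) fu] by simp
qed

text \<open>
  Dual of the weak kernel property: (TR3) maps the given triangle to 0 -> A -> A.
\<close>

lemma weak_cokernel:
  assumes t: "f \<in> Hom T X Y" "g \<in> Hom T Y Z" "(f, g, h) \<in> Tri T"
    and v: "v \<in> Hom T Y A" "Comp T v f = ZeroArr T X A"
  obtains w where "w \<in> Hom T Z A" "v = Comp T w g"
proof -
  obtain N where N: "zero_object T N" using zero_object_exists by auto
  then have N': "N \<in> Obj T" by (simp add: zero_object_def)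
  have A: "A \<in> Obj T" and X: "X \<in> Obj T" and Z: "Z \<in> Obj T"
    using hom_obj[OF v(1)] hom_obj[OF t(1)] hom_obj[OF t(2)] by auto
  have h: "h \<in> Hom T Z (ShiftObj T X)"
    using tri_homs(2)[OF t(3,1)] hom_dom_cod[OF t(2)] by simp
  note i = ident_hom[OF A]
  note z1 = zero_hom[OF N' A] and z2 = zero_hom[OF A shift_obj[OF N']]
  have r: "(ZeroArr T N A, Ident T A, ZeroArr T A (ShiftObj T N)) \<in> Tri T"
    using tri_rotate[OF z1 i z2] TR1_ident[OF A zero_object_shift[OF N]]
      Neg_zero[OF shift_obj[OF N'] shift_obj[OF A]] shift_zero[OF N' A] by simp
  note d = hom_dom_cod[OF z1] hom_dom_cod[OF z2] hom_dom_cod[OF i]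
    hom_dom_cod[OF t(1)] hom_dom_cod[OF t(2)] hom_dom_cod[OF h]
  have zx: "ZeroArr T X N \<in> Hom T X N" using zero_hom[OF X N'] .
  have "Comp T v f = Comp T (ZeroArr T N A) (ZeroArr T X N)"
    using comp_zero_left[OF A zx] v(2) by simp
  then obtain c where "triangle_morphism T (f, g, h)
     (ZeroArr T N A, Ident T A, ZeroArr T A (ShiftObj T N)) (ZeroArr T X N) v c"
    using TR3[OF t(3) r, of "ZeroArr T X N" v] v(1) zx d by auto
  then have c: "c \<in> Hom T Z A" "Comp T c g = Comp T (Ident T A) v"
    by (auto simp: triangle_morphism_def d)
  then show thesis
    using that comp_ident_left[OF v(1)] by simp
qed

lemma orthogonal_extension_right:
  assumes "distinguished T X Y Z" "orthogonal T D X" "orthogonal T D Z"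
  shows "orthogonal T D Y"
  unfolding orthogonal_def
proof (intro subsetI, simp)
  fix v assume v: "v \<in> Hom T D Y"
  obtain f g h where t: "f \<in> Hom T X Y" "g \<in> Hom T Y Z" "(f, g, h) \<in> Tri T"
    using assms(1) unfolding distinguished_def by auto
  obtain u where u: "u \<in> Hom T D X" "v = Comp T f u"
    using weak_kernel[OF t v orthogonalD[OF assms(3) comp_hom[OF v t(2)]]] .
  then show "v = ZeroArr T D Y"
    using orthogonalD[OF assms(2) u(1)] comp_zero_right[OF _ t(1)] hom_obj[OF v] by simp
qed

lemma orthogonal_extension_left:
  assumes "distinguished T X Y Z" "orthogonal T X D" "orthogonal T Z D"
  shows "orthogonal T Y D"
  unfolding orthogonal_def
proof (intro subsetI, simp)
  fix v assume v: "v \<in> Hom T Y D"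
  obtain f g h where t: "f \<in> Hom T X Y" "g \<in> Hom T Y Z" "(f, g, h) \<in> Tri T"
    using assms(1) unfolding distinguished_def by auto
  obtain u where u: "u \<in> Hom T Z D" "v = Comp T u g"
    using weak_cokernel[OF t v orthogonalD[OF assms(2) comp_hom[OF t(1) v]]] .
  then show "v = ZeroArr T Y D"
    using orthogonalD[OF assms(3) u(1)] comp_zero_left[OF _ t(2)] hom_obj[OF v] by simp
qed

text \<open>
  The exact sequence with Hom(D, Z[-1]) in front of Hom(D, X), written with \<Sigma>D instead of a
  desuspension of Z.
\<close>

lemma orthogonal_first:
  assumes t: "distinguished T X Y Z" and D: "D \<in> Obj T"
    and o: "orthogonal T D Y" "orthogonal T (ShiftObj T D) Z"
  shows "orthogonal T D X"
proof -
  have X: "X \<in> Obj T" and Y: "Y \<in> Obj T" using distinguished_obj[OF t] by auto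
  have "orthogonal T (ShiftObj T D) (ShiftObj T X)"
    by (rule orthogonal_extension_right[OF distinguished_rotate[OF distinguished_rotate[OF t]]])
      (use o orthogonal_shift_iff D Y in auto)
  then show ?thesis using orthogonal_shift_iff D X by simp
qed

lemma orthogonal_if_factors_through_zero:
  assumes "distinguished T X Y Z" "orthogonal T D Z" "orthogonal T X Y"
  shows "orthogonal T D Y"
  unfolding orthogonal_def
proof (intro subsetI, simp)
  fix v assume v: "v \<in> Hom T D Y"
  obtain f g h where t: "f \<in> Hom T X Y" "g \<in> Hom T Y Z" "(f, g, h) \<in> Tri T"
    using assms(1) unfolding distinguished_def by auto
  obtain u where u: "u \<in> Hom T D X" "v = Comp T f u"
    using weak_kernel[OF t v orthogonalD[OF assms(2) comp_hom[OF v t(2)]]] .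
  then show "v = ZeroArr T D Y"
    using orthogonalD[OF assms(3) t(1)] comp_zero_left[OF _ u(1)] hom_obj[OF v] by simp
qed

text \<open>
  If the cone vanishes, the identity of Y lifts along the arrow X -> Y and, two rotations later, the
  identity of \<Sigma>X extends along \<Sigma>X -> \<Sigma>Y; so the arrow has inverses on both sides.
\<close>

lemma isomorphic_if_cone_zero:
  assumes d: "distinguished T X Y N" and N: "zero_object T N"
  shows "isomorphic T X Y"
proof -
  obtain f g h where t: "f \<in> Hom T X Y" "g \<in> Hom T Y N" "h \<in> Hom T N (ShiftObj T X)"
     "(f, g, h) \<in> Tri T"
    using d unfolding distinguished_def by auto
  have X: "X \<in> Obj T" and Y: "Y \<in> Obj T" using hom_obj[OF t(1)] by auto
  note SX = shift_obj[OF X]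
  note sf = shift_hom[OF t(1)] and nsf = Neg_hom[OF shift_hom[OF t(1)]]
  have "Comp T g (Ident T Y) = ZeroArr T Y N"
    using orthogonalD[OF orthogonal_zero_object(1)[OF N Y]] comp_hom[OF ident_hom[OF Y] t(2)] by simp
  then obtain u where u: "u \<in> Hom T Y X" "Ident T Y = Comp T f u"
    using weak_kernel[OF t(1,2,4) ident_hom[OF Y]] by auto
  have r: "(h, Neg T (ShiftArr T f), Neg T (ShiftArr T g)) \<in> Tri T"
    using t(4) tri_rotate[OF t(1-3)] tri_rotate[OF t(2,3) nsf] by simp
  have "Comp T (Ident T (ShiftObj T X)) h = ZeroArr T N (ShiftObj T X)"
    using orthogonalD[OF orthogonal_zero_object(2)[OF N SX]] comp_hom[OF t(3) ident_hom[OF SX]]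
    by simp
  then obtain w where w: "w \<in> Hom T (ShiftObj T Y) (ShiftObj T X)"
      "Ident T (ShiftObj T X) = Comp T w (Neg T (ShiftArr T f))"
    using weak_cokernel[OF t(3) nsf r ident_hom[OF SX]] by auto
  obtain w' where w': "w' \<in> Hom T Y X" "ShiftArr T w' = Neg T w"
    using shift_full[OF Y X Neg_hom[OF w(1)]] .
  have "ShiftArr T (Comp T w' f) = ShiftArr T (Ident T X)"
    using shift_comp[OF t(1) w'(1)] w'(2) w(2) comp_Neg_left[OF sf w(1)] comp_Neg_right[OF sf w(1)]
      shift_ident[OF X] by simp
  then have "Comp T w' f = Ident T X"
    using shift_faithful[OF comp_hom[OF t(1) w'(1)] ident_hom[OF X]] by simp
  then show ?thesis
    using isomorphic_if_one_sided_inverses[OF t(1) u(1) _ w'(1)] u(2) by simp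
qed

text \<open>
  With this, closure under extensions gives closure under direct sums. The cone C of the inclusion i1
  is identified with Y: the projection p2 factors through P -> C, and P -> C composed with i2 is its
  inverse.
\<close>

lemma biproduct_distinguished:
  assumes b: "biproduct T X Y P i1 i2 p1 p2"
  shows "distinguished T X P Y"
proof -
  have h: "i1 \<in> Hom T X P" "i2 \<in> Hom T Y P" "p1 \<in> Hom T P X" "p2 \<in> Hom T P Y"
    and e: "Comp T p1 i1 = Ident T X" "Comp T p2 i2 = Ident T Y"
    "Comp T p1 i2 = ZeroArr T Y X" "Comp T p2 i1 = ZeroArr T X Y"
    "Add T (Comp T i1 p1) (Comp T i2 p2) = Ident T P"
    using b by (auto simp: biproduct_def)
  obtain g k where gk: "(i1, g, k) \<in> Tri T"
    using TR1_cone[of i1] hom_dom_cod[OF h(1)] by auto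
  define C where "C = Cod T g"
  have g: "g \<in> Hom T P C" and k: "k \<in> Hom T C (ShiftObj T X)"
    using tri_homs[OF gk h(1)] by (auto simp: C_def)
  have C: "C \<in> Obj T" and X: "X \<in> Obj T" using hom_obj[OF g] hom_obj[OF h(1)] by auto
  obtain w where w: "w \<in> Hom T C Y" "p2 = Comp T w g"
    using weak_cokernel[OF h(1) g gk h(4) e(4)] .
  let ?s = "Comp T g i2"
  have s: "?s \<in> Hom T Y C" using comp_hom[OF h(2) g] .
  have ws: "Comp T w ?s = Ident T Y"
    using comp_assoc[OF h(2) g w(1)] w(2) e(2) by simp
  have P: "P \<in> Obj T" using hom_obj[OF g] by simp
  have q1: "Comp T i1 p1 \<in> Hom T P P" and q2: "Comp T i2 p2 \<in> Hom T P P"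
    using comp_hom[OF h(3,1)] comp_hom[OF h(4,2)] by auto
  \<comment> \<open>The idempotent on the first summand dies in the cone.\<close>
  have "Comp T g (Comp T i1 p1) = ZeroArr T P C"
    using comp_assoc[OF h(3,1) g] tri_comp_zero[OF h(1) g gk] comp_zero_left[OF C h(3)] by simp
  then have "g = Add T (ZeroArr T P C) (Comp T g (Comp T i2 p2))"
    using comp_add_right[OF q1 q2 g] e(5) comp_ident_right[OF g] by simp
  also have "\<dots> = Comp T g (Comp T i2 p2)"
    using add_zero(2)[OF comp_hom[OF q2 g]] .
  also have "\<dots> = Comp T ?s (Comp T w g)"
    using comp_assoc[OF h(4,2) g] w(2) by simp
  also have "\<dots> = Comp T (Comp T ?s w) g"
    using comp_assoc[OF g w(1) s] .
  finally have swg: "Comp T (Comp T ?s w) g = g" by simp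
  have r: "(g, k, Neg T (ShiftArr T i1)) \<in> Tri T"
    using gk tri_rotate[OF h(1) g k] by simp
  have r2: "(k, Neg T (ShiftArr T i1), Neg T (ShiftArr T g)) \<in> Tri T"
    using r tri_rotate[OF g k Neg_hom[OF shift_hom[OF h(1)]]] by simp
  \<comment> \<open>As i1 is a split monomorphism, the connecting map k vanishes and g is a split epimorphism.\<close>
  have si: "Comp T (Neg T (ShiftArr T i1)) k = ZeroArr T C (ShiftObj T P)"
    using tri_comp_zero[OF k Neg_hom[OF shift_hom[OF h(1)]] r2] .
  have ii: "Comp T (Neg T (ShiftArr T p1)) (Neg T (ShiftArr T i1)) = Ident T (ShiftObj T X)"
    using comp_Neg_left[OF Neg_hom[OF shift_hom[OF h(1)]] shift_hom[OF h(3)]]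
      comp_Neg_right[OF shift_hom[OF h(1)] shift_hom[OF h(3)]] shift_comp[OF h(1,3)] e(1)
      shift_ident[OF X] Neg_Neg[OF ident_hom[OF shift_obj[OF X]]] by simp
  have "k = Comp T (Comp T (Neg T (ShiftArr T p1)) (Neg T (ShiftArr T i1))) k"
    using ii comp_ident_left[OF k] by simp
  also have "\<dots> = ZeroArr T C (ShiftObj T X)"
    using comp_assoc[OF k Neg_hom[OF shift_hom[OF h(1)]] Neg_hom[OF shift_hom[OF h(3)]]] si
      comp_zero_right[OF C Neg_hom[OF shift_hom[OF h(3)]]] by simp
  finally have "Comp T k (Ident T C) = ZeroArr T C (ShiftObj T X)"
    using comp_ident_right[OF k] by simp
  then obtain t where t: "t \<in> Hom T C P" "Ident T C = Comp T g t"
    using weak_kernel[OF g k r ident_hom[OF C]] by auto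
  have sw: "Comp T ?s w \<in> Hom T C C" using comp_hom[OF w(1) s] .
  have "Comp T ?s w = Comp T (Comp T ?s w) (Comp T g t)"
    using t(2) comp_ident_right[OF sw] by simp
  also have "\<dots> = Ident T C"
    using comp_assoc[OF t(1) g sw] swg t(2) by simp
  finally have "isomorphic T C Y"
    unfolding isomorphic_iff using w(1) s ws by auto
  moreover have "distinguished T X P C"
    unfolding distinguished_def using h(1) g k gk by auto
  ultimately show ?thesis using distinguished_iso_right by simp
qed

end

section \<open>Aisles and the bounded part\<close>

definition right_orthogonal :: "('o, 'm) tcat \<Rightarrow> 'o set \<Rightarrow> 'o \<Rightarrow> bool" where
  "right_orthogonal T A W \<longleftrightarrow> (\<forall>X \<in> A. orthogonal T X W)"

text \<open>
  An aisle is the first half of a t-structure, described without its second half: the truncation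
  triangles only refer to the right orthogonal. A t-structure and its aisle determine each other.
\<close>

definition aisle :: "('o, 'm) tcat \<Rightarrow> 'o set \<Rightarrow> bool" where
  "aisle T A \<longleftrightarrow> strictly_full T A \<and> (\<forall>X \<in> A. ShiftObj T X \<in> A) \<and>
     (\<forall>Z \<in> Obj T. \<exists>X \<in> A. \<exists>W. right_orthogonal T A W \<and> distinguished T X Z W)"

definition coaisle :: "('o, 'm) tcat \<Rightarrow> 'o set \<Rightarrow> 'o set" where
  "coaisle T A = {Y \<in> Obj T. \<forall>X \<in> A. orthogonal T (ShiftObj T X) Y}"

text \<open>
  The bounded objects in terms of the aisle alone: the first condition bounds Y above, and the second
  one, by orthogonality, bounds it below. A single n serves for both because each condition persists
  when n grows.
\<close>

definition bounded_part :: "('o, 'm) tcat \<Rightarrow> 'o set \<Rightarrow> 'o set" where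
  "bounded_part T A = {Y \<in> Obj T. \<exists>n. (ShiftObj T ^^ n) Y \<in> A \<and>
     (\<forall>X \<in> A. orthogonal T ((ShiftObj T ^^ n) X) Y)}"

text \<open>
  For aisles this says that the t-structures have finite distance: powers of \<Sigma> move each
  aisle into the other.
\<close>

definition commensurable :: "('o, 'm) tcat \<Rightarrow> 'o set \<Rightarrow> 'o set \<Rightarrow> bool" where
  "commensurable T A B \<longleftrightarrow> (\<exists>n. (\<forall>X \<in> A. (ShiftObj T ^^ n) X \<in> B) \<and>
     (\<forall>X \<in> B. (ShiftObj T ^^ n) X \<in> A))"

lemma funpow_split: "m \<le> n \<Longrightarrow> (f ^^ n) x = (f ^^ m) ((f ^^ (n - m)) x)"
  using funpow_add[of m "n - m" f] by simp

text \<open>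
  Closure under cones and cocones follows from closure under extensions and under \<Sigma> in both
  directions.
\<close>

locale triangulated_subcategory = triangulated_category T for T :: "('o, 'm) tcat" +
  fixes S :: "'o set"
  assumes sub_strictly_full: "strictly_full T S"
    and sub_zero: "zero_object T N \<Longrightarrow> N \<in> S"
    and sub_shift: "X \<in> S \<Longrightarrow> ShiftObj T X \<in> S"
    and sub_unshift: "\<lbrakk>X \<in> Obj T; ShiftObj T X \<in> S\<rbrakk> \<Longrightarrow> X \<in> S"
    and sub_extension: "\<lbrakk>distinguished T X Y Z; X \<in> S; Z \<in> S\<rbrakk> \<Longrightarrow> Y \<in> S"

context triangulated_category
begin

lemma aisle_strictly_full: "aisle T A \<Longrightarrow> strictly_full T A"
  by (simp add: aisle_def)

lemma aisle_obj: "\<lbrakk>aisle T A; X \<in> A\<rbrakk> \<Longrightarrow> X \<in> Obj T"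
  using strictly_full_obj aisle_strictly_full by blast

lemma aisle_iso: "\<lbrakk>aisle T A; X \<in> A; isomorphic T X Y\<rbrakk> \<Longrightarrow> Y \<in> A"
  using strictly_full_iso aisle_strictly_full by blast

lemma aisle_shift: "\<lbrakk>aisle T A; X \<in> A\<rbrakk> \<Longrightarrow> ShiftObj T X \<in> A"
  by (simp add: aisle_def)

lemma aisle_shift_pow: "\<lbrakk>aisle T A; X \<in> A\<rbrakk> \<Longrightarrow> (ShiftObj T ^^ n) X \<in> A"
  by (induction n) (auto intro: aisle_shift)

lemma aisle_shift_pow_mono:
  assumes "aisle T A" "(ShiftObj T ^^ m) X \<in> A" "m \<le> n"
  shows "(ShiftObj T ^^ n) X \<in> A"
  using aisle_shift_pow[OF assms(1,2), of "n - m"] funpow_add[of "n - m" m "ShiftObj T"] assms(3)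
  by simp

lemma aisle_truncation:
  assumes "aisle T A" "Z \<in> Obj T"
  obtains X W where "X \<in> A" "right_orthogonal T A W" "distinguished T X Z W"
  using assms by (auto simp: aisle_def)

lemma right_orthogonalD: "\<lbrakk>right_orthogonal T A W; X \<in> A\<rbrakk> \<Longrightarrow> orthogonal T X W"
  by (simp add: right_orthogonal_def)

text \<open>
  An aisle is the left orthogonal of its right orthogonal. In the truncation triangle P -> X -> W both
  X and \<Sigma>P have no arrows to W, hence neither has W itself, so W = 0 and P is isomorphic to X.
  This makes aisles closed under extensions.
\<close>

lemma aisle_if_orthogonal:
  assumes A: "aisle T A" and X: "X \<in> Obj T"
    and o: "\<And>W. right_orthogonal T A W \<Longrightarrow> orthogonal T X W"
  shows "X \<in> A"
proof -
  obtain P W where P: "P \<in> A" "right_orthogonal T A W" "distinguished T P X W"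
    using aisle_truncation[OF A X] .
  have "orthogonal T W W"
    by (rule orthogonal_extension_left[OF distinguished_rotate[OF P(3)] o[OF P(2)]])
      (rule right_orthogonalD[OF P(2) aisle_shift[OF A P(1)]])
  then have "zero_object T W"
    using distinguished_obj[OF P(3)] by (simp add: zero_object_iff)
  then show ?thesis
    using aisle_iso[OF A P(1) isomorphic_if_cone_zero[OF P(3)]] by simp
qed

lemma right_orthogonal_aisle: 
  "\<lbrakk>aisle T A; X \<in> A; right_orthogonal T A W\<rbrakk> \<Longrightarrow> orthogonal T (ShiftObj T X) W"
  using right_orthogonalD aisle_shift by blast

lemma aisle_extension:
  assumes "aisle T A" "distinguished T X Y Z" "X \<in> A" "Z \<in> A"
  shows "Y \<in> A"
proof (rule aisle_if_orthogonal[OF assms(1)])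
  show "Y \<in> Obj T" using distinguished_obj[OF assms(2)] by simp
qed (rule orthogonal_extension_left[OF assms(2)], auto intro: right_orthogonalD assms)

lemma aisle_cone:
  assumes "aisle T A" "distinguished T X Y Z" "X \<in> A" "Y \<in> A"
  shows "Z \<in> A"
  using aisle_extension[OF assms(1) distinguished_rotate[OF assms(2)] assms(4)]
    aisle_shift[OF assms(1,3)] by simp

lemma aisle_zero:
  assumes "aisle T A" "zero_object T N"
  shows "N \<in> A"
proof -
  have N: "N \<in> Obj T" using assms(2) by (simp add: zero_object_def)
  show ?thesis
  proof (rule aisle_if_orthogonal[OF assms(1) N])
    fix V
    show "orthogonal T N V"
      unfolding orthogonal_def
    proof (intro subsetI, simp)
      fix v assume v: "v \<in> Hom T N V"
      have "Ident T N = ZeroArr T N N"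
        using orthogonalD[OF orthogonal_zero_object(1)[OF assms(2) N] ident_hom[OF N]] .
      then show "v = ZeroArr T N V"
        using comp_ident_right[OF v] comp_zero_right[OF N v] by simp
    qed
  qed
qed

lemma shift_class_nat:
  "shift_class T (int n) A = {Y \<in> Obj T. \<exists>X \<in> A. isomorphic T ((ShiftObj T ^^ n) X) Y}"
  by (simp add: shift_class_def)

lemma shift_class_neg:
  assumes "strictly_full T A"
  shows "shift_class T (- int n) A = {Y \<in> Obj T. (ShiftObj T ^^ n) Y \<in> A}"
proof -
  have "(\<exists>X \<in> A. isomorphic T X ((ShiftObj T ^^ n) Y)) \<longleftrightarrow> (ShiftObj T ^^ n) Y \<in> A"
    if "Y \<in> Obj T" for Y
    using isomorphic_refl[OF shift_pow_obj[OF that, of n]] strictly_full_iso[OF assms] by blast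
  then show ?thesis by (auto simp: shift_class_def)
qed

lemma strictly_full_coaisle: "strictly_full T (coaisle T A)"
  unfolding strictly_full_def coaisle_def using orthogonal_iso_right by blast

lemma shift_mem_coaisle_iff:
  assumes "A \<subseteq> Obj T" "W \<in> Obj T"
  shows "ShiftObj T W \<in> coaisle T A \<longleftrightarrow> right_orthogonal T A W"
  using assms orthogonal_shift_iff shift_obj[OF assms(2)]
  by (auto simp: coaisle_def right_orthogonal_def)

text \<open>
  The second half of a t-structure is recovered as the right orthogonal of \<Sigma> of the aisle. For
  an object of that orthogonal, the truncation of a desuspension V of it has vanishing first term,
  so V is isomorphic to the other term, whose translate lies in the second half.
\<close>

lemma t_structure_iff:
  "t_structure T U \<longleftrightarrow> aisle T (fst U) \<and> snd U = coaisle T (fst U)"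
proof
  assume "t_structure T U"
  then interpret U: t_structure T U .
  have AO: "fst U \<subseteq> Obj T" using U.le_strictly_full by (simp add: strictly_full_def)
  note sc = shift_class_neg[of _ 1, simplified]
  have W: "right_orthogonal T (fst U) W" if "W \<in> Obj T" "ShiftObj T W \<in> snd U" for W
    using U.T2 that by (simp add: right_orthogonal_def orthogonal_def sc[OF U.ge_strictly_full])
  have tr: "\<exists>X \<in> fst U. \<exists>W. right_orthogonal T (fst U) W \<and> W \<in> Obj T \<and> ShiftObj T W \<in> snd U \<and>
      distinguished T X Z W" if Z: "Z \<in> Obj T" for Z
  proof -
    have "\<exists>X \<in> fst U. \<exists>W \<in> shift_class T (- 1) (snd U). distinguished T X Z W"
      unfolding distinguished_def by (rule U.T3[OF Z])
    then obtain X W' where X: "X \<in> fst U" "W' \<in> shift_class T (- 1) (snd U)"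
        "distinguished T X Z W'"
      by auto
    then show ?thesis using W[of W'] unfolding sc[OF U.ge_strictly_full] by blast
  qed
  have sh: "ShiftObj T X \<in> fst U" if "X \<in> fst U" for X
  proof -
    have SX: "ShiftObj T X \<in> Obj T" using shift_obj AO that by auto
    have "ShiftObj T X \<in> shift_class T (int 1) (fst U)"
      unfolding shift_class_nat using SX isomorphic_refl[OF SX] that by auto
    then show ?thesis using U.T1_le by auto
  qed
  have A: "aisle T (fst U)"
    unfolding aisle_def using U.le_strictly_full sh tr by blast
  have "Y \<in> coaisle T (fst U)" if Y: "Y \<in> snd U" for Y
  proof -
    have YO: "Y \<in> Obj T" using strictly_full_obj[OF U.ge_strictly_full Y] .
    obtain V where V: "V \<in> Obj T" "isomorphic T (ShiftObj T V) Y"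
      using shift_ess_surj[OF YO] by blast
    have "ShiftObj T V \<in> snd U"
      using strictly_full_iso[OF U.ge_strictly_full Y isomorphic_sym[OF V(2)]] .
    then have "ShiftObj T V \<in> coaisle T (fst U)"
      using W[OF V(1)] shift_mem_coaisle_iff[OF AO V(1)] by simp
    then show ?thesis using strictly_full_iso[OF strictly_full_coaisle _ V(2)] by simp
  qed
  moreover have "Y \<in> snd U" if Y: "Y \<in> coaisle T (fst U)" for Y
  proof -
    have YO: "Y \<in> Obj T" using Y by (simp add: coaisle_def)
    obtain V where V: "V \<in> Obj T" "isomorphic T (ShiftObj T V) Y"
      using shift_ess_surj[OF YO] by blast
    have oV: "ShiftObj T V \<in> coaisle T (fst U)"
      using strictly_full_iso[OF strictly_full_coaisle Y isomorphic_sym[OF V(2)]] .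
    obtain X W' where X: "X \<in> fst U" "right_orthogonal T (fst U) W'" "ShiftObj T W' \<in> snd U"
      "distinguished T X V W'"
      using tr[OF V(1)] by blast
    have "orthogonal T (ShiftObj T X) (ShiftObj T X)"
      by (rule orthogonal_extension_right[OF distinguished_rotate[OF distinguished_rotate[OF X(4)]]])
        (use oV X in \<open>auto simp: coaisle_def intro: right_orthogonal_aisle[OF A]\<close>)
    then have "zero_object T (ShiftObj T X)"
      using shift_obj AO X(1) by (auto simp: zero_object_iff)
    then have "isomorphic T V W'"
      using isomorphic_if_cone_zero[OF distinguished_rotate[OF X(4)]] by simp
    then have "isomorphic T (ShiftObj T W') Y"
      using isomorphic_trans[OF isomorphic_sym[OF isomorphic_shift] V(2)] by simp
    then show ?thesis using strictly_full_iso[OF U.ge_strictly_full X(3)] by simp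
  qed
  ultimately show "aisle T (fst U) \<and> snd U = coaisle T (fst U)" using A by blast
next
  assume *: "aisle T (fst U) \<and> snd U = coaisle T (fst U)"
  then have A: "aisle T (fst U)" and co: "snd U = coaisle T (fst U)" by auto
  have AO: "fst U \<subseteq> Obj T" using aisle_obj[OF A] by blast
  note sf = strictly_full_coaisle[of "fst U"]
  have sc: "shift_class T (- 1) (snd U) = {W \<in> Obj T. right_orthogonal T (fst U) W}"
    using shift_class_neg[OF sf, of 1] shift_mem_coaisle_iff[OF AO] by (auto simp: co)
  show "t_structure T U"
  proof
    show "strictly_full T (fst U)" "strictly_full T (snd U)"
      using aisle_strictly_full[OF A] sf co by auto
    show "shift_class T 1 (fst U) \<subseteq> fst U"
      using shift_class_nat[of 1 "fst U"] aisle_iso[OF A aisle_shift[OF A]] by auto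
    show "shift_class T (- 1) (snd U) \<subseteq> snd U"
      unfolding sc by (auto simp: co coaisle_def intro: right_orthogonal_aisle[OF A])
    show "Hom T X Y = {ZeroArr T X Y}" if "X \<in> fst U" "Y \<in> shift_class T (- 1) (snd U)" for X Y
      using that AO orthogonal_iff unfolding sc right_orthogonal_def by blast
    show "\<exists>X \<in> fst U. \<exists>W \<in> shift_class T (- 1) (snd U).
        \<exists>f \<in> Hom T X Z. \<exists>g \<in> Hom T Z W. \<exists>h \<in> Hom T W (ShiftObj T X). (f, g, h) \<in> Tri T"
      if Z: "Z \<in> Obj T" for Z
    proof -
      obtain X W where "X \<in> fst U" "right_orthogonal T (fst U) W" "distinguished T X Z W"
        using aisle_truncation[OF A Z] .
      then show ?thesis
        unfolding sc using distinguished_obj[of X Z W] unfolding distinguished_def by blast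
    qed
  qed
qed

lemma orthogonal_shift_pow_mono:
  assumes "aisle T A" "m \<le> n" "\<And>X. X \<in> A \<Longrightarrow> orthogonal T ((ShiftObj T ^^ m) X) Y" "X \<in> A"
  shows "orthogonal T ((ShiftObj T ^^ n) X) Y"
  using assms(3)[OF aisle_shift_pow[OF assms(1,4), of "n - m"]] assms(2)
  by (simp add: funpow_split[OF assms(2)])

lemma bounded_part_common_bound:
  assumes A: "aisle T A" and Y: "Y \<in> bounded_part T A" and Z: "Z \<in> bounded_part T A"
  obtains n where "(ShiftObj T ^^ n) Y \<in> A" "\<And>X. X \<in> A \<Longrightarrow> orthogonal T ((ShiftObj T ^^ n) X) Y"
    "(ShiftObj T ^^ n) Z \<in> A" "\<And>X. X \<in> A \<Longrightarrow> orthogonal T ((ShiftObj T ^^ n) X) Z"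
proof -
  obtain k where k: "(ShiftObj T ^^ k) Y \<in> A" "\<And>X. X \<in> A \<Longrightarrow> orthogonal T ((ShiftObj T ^^ k) X) Y"
    using Y by (auto simp: bounded_part_def)
  obtain l where l: "(ShiftObj T ^^ l) Z \<in> A" "\<And>X. X \<in> A \<Longrightarrow> orthogonal T ((ShiftObj T ^^ l) X) Z"
    using Z by (auto simp: bounded_part_def)
  show thesis
  proof (rule that[of "max k l"])
    show "(ShiftObj T ^^ max k l) Y \<in> A" "(ShiftObj T ^^ max k l) Z \<in> A"
      using aisle_shift_pow_mono[OF A k(1)] aisle_shift_pow_mono[OF A l(1)] by auto
    show "orthogonal T ((ShiftObj T ^^ max k l) X) Y" if "X \<in> A" for X
      by (rule orthogonal_shift_pow_mono[OF A _ k(2) that]) auto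
    show "orthogonal T ((ShiftObj T ^^ max k l) X) Z" if "X \<in> A" for X
      by (rule orthogonal_shift_pow_mono[OF A _ l(2) that]) auto
  qed
qed

lemma bounded_partI:
  "\<lbrakk>Y \<in> Obj T; (ShiftObj T ^^ n) Y \<in> A; \<And>X. X \<in> A \<Longrightarrow> orthogonal T ((ShiftObj T ^^ n) X) Y\<rbrakk>
   \<Longrightarrow> Y \<in> bounded_part T A"
  unfolding bounded_part_def by blast

text \<open>
  The bound above is inherited by extensions as aisles are extension closed, the bound below as
  vanishing of Hom(D, -) is.
\<close>

lemma bounded_part_triangulated:
  assumes A: "aisle T A"
  shows "triangulated_subcategory T (bounded_part T A)"
proof
  show "strictly_full T (bounded_part T A)"
    unfolding strictly_full_def
  proof (intro conjI ballI impI)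
    show "bounded_part T A \<subseteq> Obj T" by (auto simp: bounded_part_def)
    fix X Y assume X: "X \<in> bounded_part T A" and Y: "Y \<in> Obj T" and i: "isomorphic T X Y"
    obtain n where "(ShiftObj T ^^ n) X \<in> A" "\<And>P. P \<in> A \<Longrightarrow> orthogonal T ((ShiftObj T ^^ n) P) X"
      using X by (auto simp: bounded_part_def)
    then show "Y \<in> bounded_part T A"
      using bounded_partI[OF Y aisle_iso[OF A _ isomorphic_shift_pow[OF i]]]
        orthogonal_iso_right[OF _ i] by blast
  qed
next
  fix N assume N: "zero_object T N"
  then have NO: "N \<in> Obj T" by (simp add: zero_object_def)
  show "N \<in> bounded_part T A"
    using bounded_partI[OF NO, of 0 A] aisle_zero[OF A N] orthogonal_zero_object(1)[OF N]
      aisle_obj[OF A] by simp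
next
  fix X assume X: "X \<in> bounded_part T A"
  then have XO: "X \<in> Obj T" by (auto simp: bounded_part_def)
  obtain n where n: "(ShiftObj T ^^ n) X \<in> A" "\<And>P. P \<in> A \<Longrightarrow> orthogonal T ((ShiftObj T ^^ n) P) X"
    using X by (auto simp: bounded_part_def)
  show "ShiftObj T X \<in> bounded_part T A"
  proof (rule bounded_partI[OF shift_obj[OF XO]])
    have "ShiftObj T ((ShiftObj T ^^ Suc n) X) \<in> A"
      using aisle_shift[OF A aisle_shift[OF A n(1)]] by simp
    then show "(ShiftObj T ^^ Suc n) (ShiftObj T X) \<in> A"
      by (simp add: funpow_swap1)
    show "orthogonal T ((ShiftObj T ^^ Suc n) P) (ShiftObj T X)" if "P \<in> A" for P
      using n(2)[OF that] orthogonal_shift_iff[OF shift_pow_obj[OF aisle_obj[OF A that]] XO] by simp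
  qed
next
  fix X assume XO: "X \<in> Obj T" and X: "ShiftObj T X \<in> bounded_part T A"
  obtain n where n: "(ShiftObj T ^^ n) (ShiftObj T X) \<in> A"
      "\<And>P. P \<in> A \<Longrightarrow> orthogonal T ((ShiftObj T ^^ n) P) (ShiftObj T X)"
    using X by (auto simp: bounded_part_def)
  show "X \<in> bounded_part T A"
  proof (rule bounded_partI[OF XO])
    show "(ShiftObj T ^^ Suc n) X \<in> A"
      using n(1) by (simp add: funpow_swap1)
    show "orthogonal T ((ShiftObj T ^^ Suc n) P) X" if P: "P \<in> A" for P
    proof -
      have "orthogonal T ((ShiftObj T ^^ Suc n) (ShiftObj T P)) (ShiftObj T X)"
        by (rule orthogonal_shift_pow_mono[OF A _ n(2) aisle_shift[OF A P]]) auto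
      then have "orthogonal T (ShiftObj T ((ShiftObj T ^^ Suc n) P)) (ShiftObj T X)"
        by (simp add: funpow_swap1)
      then show ?thesis
        using orthogonal_shift_iff[OF shift_pow_obj[OF aisle_obj[OF A P]] XO] by blast
    qed
  qed
next
  fix X Y Z assume d: "distinguished T X Y Z" and XZ: "X \<in> bounded_part T A" "Z \<in> bounded_part T A"
  obtain n where n: "(ShiftObj T ^^ n) X \<in> A" "\<And>P. P \<in> A \<Longrightarrow> orthogonal T ((ShiftObj T ^^ n) P) X"
    "(ShiftObj T ^^ n) Z \<in> A" "\<And>P. P \<in> A \<Longrightarrow> orthogonal T ((ShiftObj T ^^ n) P) Z"
    using bounded_part_common_bound[OF A XZ] by blast
  show "Y \<in> bounded_part T A"
  proof (rule bounded_partI)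
    show "Y \<in> Obj T" using distinguished_obj[OF d] by simp
    show "(ShiftObj T ^^ n) Y \<in> A"
      using aisle_extension[OF A distinguished_shift_pow[OF d] n(1,3)] .
    show "orthogonal T ((ShiftObj T ^^ n) P) Y" if "P \<in> A" for P
      using orthogonal_extension_right[OF d n(2)[OF that] n(4)[OF that]] .
  qed
qed

lemma t_bounded_objects_eq:
  assumes "t_structure T U"
  shows "t_bounded_objects T U = bounded_part T (fst U)"
proof -
  have A: "aisle T (fst U)" and co: "snd U = coaisle T (fst U)"
    using assms by (auto simp: t_structure_iff)
  have int: "t_interval T U (- int n) (int n) = {Y \<in> Obj T. (ShiftObj T ^^ n) Y \<in> fst U \<and>
      (\<exists>X \<in> coaisle T (fst U). isomorphic T ((ShiftObj T ^^ n) X) Y)}" for n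
    using shift_class_neg[OF aisle_strictly_full[OF A]] shift_class_nat
    by (auto simp: t_interval_def t_ge_def t_le_def co)
  show ?thesis
  proof
    show "t_bounded_objects T U \<subseteq> bounded_part T (fst U)"
    proof
      fix Y assume "Y \<in> t_bounded_objects T U"
      then obtain n X where Y: "Y \<in> Obj T" "(ShiftObj T ^^ n) Y \<in> fst U"
        "X \<in> coaisle T (fst U)" "isomorphic T ((ShiftObj T ^^ n) X) Y"
        by (auto simp: t_bounded_objects_def int)
      show "Y \<in> bounded_part T (fst U)"
      proof (rule bounded_partI[OF Y(1)])
        show "(ShiftObj T ^^ Suc n) Y \<in> fst U" using aisle_shift[OF A Y(2)] by simp
        fix P assume P: "P \<in> fst U"
        have "orthogonal T (ShiftObj T P) X" "X \<in> Obj T"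
          using Y(3) P by (auto simp: coaisle_def)
        then have "orthogonal T ((ShiftObj T ^^ n) (ShiftObj T P)) ((ShiftObj T ^^ n) X)"
          using orthogonal_shift_pow_iff[OF aisle_obj[OF A aisle_shift[OF A P]]] by blast
        then show "orthogonal T ((ShiftObj T ^^ Suc n) P) Y"
          using orthogonal_iso_right[OF _ Y(4)] by (simp add: funpow_swap1)
      qed
    qed
    show "bounded_part T (fst U) \<subseteq> t_bounded_objects T U"
    proof
      fix Y assume Y: "Y \<in> bounded_part T (fst U)"
      obtain n where n: "(ShiftObj T ^^ n) Y \<in> fst U"
         "\<And>P. P \<in> fst U \<Longrightarrow> orthogonal T ((ShiftObj T ^^ n) P) Y"
        using Y by (auto simp: bounded_part_def)
      have YO: "Y \<in> Obj T" using Y by (simp add: bounded_part_def)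
      obtain X where X: "X \<in> Obj T" "isomorphic T ((ShiftObj T ^^ n) X) Y"
        using shift_pow_ess_surj[OF YO] by blast
      have "orthogonal T P X" if "P \<in> fst U" for P
        using orthogonal_iso_right[OF n(2)[OF that] isomorphic_sym[OF X(2)]]
          orthogonal_shift_pow_iff[OF aisle_obj[OF A that] X(1)] by blast
      then have "X \<in> coaisle T (fst U)"
        using X(1) aisle_shift[OF A] by (auto simp: coaisle_def)
      then show "Y \<in> t_bounded_objects T U"
        using YO n(1) X(2) by (auto simp: t_bounded_objects_def int)
    qed
  qed
qed

end

section \<open>Triangulated subcategories\<close>

context triangulated_subcategory
begin

abbreviation "sub \<equiv> full_subcategory T S"

lemma sub_obj: "X \<in> S \<Longrightarrow> X \<in> Obj T"
  using strictly_full_obj[OF sub_strictly_full] .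

lemma sub_iso: "\<lbrakk>X \<in> S; isomorphic T X Y\<rbrakk> \<Longrightarrow> Y \<in> S"
  using strictly_full_iso[OF sub_strictly_full] .

lemma sub_third: "\<lbrakk>distinguished T X Y Z; X \<in> S; Y \<in> S\<rbrakk> \<Longrightarrow> Z \<in> S"
  using sub_extension[OF distinguished_rotate] sub_shift by simp

lemma sub_first:
  assumes d: "distinguished T X Y Z" and "Y \<in> S" "Z \<in> S"
  shows "X \<in> S"
  using sub_unshift sub_third[OF distinguished_rotate[OF d]] distinguished_obj[OF d] assms(2,3)
  by simp

lemma sub_shift_pow: "X \<in> S \<Longrightarrow> (ShiftObj T ^^ n) X \<in> S"
  by (induction n) (auto intro: sub_shift)

lemma sub_unshift_pow: "\<lbrakk>X \<in> Obj T; (ShiftObj T ^^ n) X \<in> S\<rbrakk> \<Longrightarrow> X \<in> S"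
  by (induction n) (auto dest: sub_unshift[rotated] intro: shift_pow_obj)

lemma sub_select [simp]:
  "Obj sub = S" "Dom sub = Dom T" "Cod sub = Cod T" "Ident sub = Ident T" "Comp sub = Comp T"
  "Add sub = Add T" "ZeroArr sub = ZeroArr T" "ShiftObj sub = ShiftObj T"
  "ShiftArr sub = ShiftArr T"
  by (simp_all add: full_subcategory_def)

lemma mem_Arr_sub: "f \<in> Arr sub \<longleftrightarrow> f \<in> Arr T \<and> Dom T f \<in> S \<and> Cod T f \<in> S"
  by (simp add: full_subcategory_def)

lemma mem_Tri_sub: "(f, g, h) \<in> Tri sub \<longleftrightarrow>
    (f, g, h) \<in> Tri T \<and> Dom T f \<in> S \<and> Dom T g \<in> S \<and> Dom T h \<in> S \<and> Cod T h \<in> S"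
  by (simp add: full_subcategory_def)

lemma mem_Hom_sub: "f \<in> Hom sub X Y \<longleftrightarrow> f \<in> Hom T X Y \<and> X \<in> S \<and> Y \<in> S"
  by (auto simp: Hom_def mem_Arr_sub)

lemma Hom_sub: "\<lbrakk>X \<in> S; Y \<in> S\<rbrakk> \<Longrightarrow> Hom sub X Y = Hom T X Y"
  by (auto simp: mem_Hom_sub)

lemma HomGroup_sub: "\<lbrakk>X \<in> S; Y \<in> S\<rbrakk> \<Longrightarrow> HomGroup sub X Y = HomGroup T X Y"
  by (simp add: HomGroup_def Hom_sub)

lemma Neg_sub: "\<lbrakk>Dom T f \<in> S; Cod T f \<in> S\<rbrakk> \<Longrightarrow> Neg sub f = Neg T f"
  by (simp add: Neg_def HomGroup_sub)

lemma is_iso_sub: "f \<in> Arr sub \<Longrightarrow> is_iso sub f \<longleftrightarrow> is_iso T f"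
  by (auto simp: is_iso_def mem_Arr_sub mem_Hom_sub)

lemma isomorphic_sub: "\<lbrakk>X \<in> S; Y \<in> S\<rbrakk> \<Longrightarrow> isomorphic sub X Y \<longleftrightarrow> isomorphic T X Y"
  using is_iso_sub by (auto simp: isomorphic_def mem_Hom_sub mem_Arr_sub Hom_def)

lemma zero_object_sub: "zero_object sub N \<longleftrightarrow> zero_object T N"
proof
  assume N: "zero_object sub N"
  then have NS: "N \<in> S" by (simp add: zero_object_def)
  then have "\<exists>!f. f \<in> Hom T N N"
    using N by (simp add: zero_object_def Hom_sub)
  then have "orthogonal T N N"
    unfolding orthogonal_def using zero_hom[OF sub_obj[OF NS] sub_obj[OF NS]] by auto
  then show "zero_object T N" using sub_obj[OF NS] by (simp add: zero_object_iff)
next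
  assume N: "zero_object T N"
  then show "zero_object sub N"
    using sub_zero[OF N] sub_obj by (simp add: zero_object_def Hom_sub)
qed

lemma biproduct_sub:
  "\<lbrakk>X \<in> S; Y \<in> S; P \<in> S\<rbrakk> \<Longrightarrow>
   biproduct sub X Y P i1 i2 p1 p2 \<longleftrightarrow> biproduct T X Y P i1 i2 p1 p2"
  by (simp add: biproduct_def Hom_sub sub_obj)

lemma candidate_triangle_sub:
  "candidate_triangle sub f g h \<longleftrightarrow>
   candidate_triangle T f g h \<and> Dom T f \<in> S \<and> Dom T g \<in> S \<and> Dom T h \<in> S"
  by (auto simp: candidate_triangle_def mem_Arr_sub sub_shift)

lemma Tri_sub_dom:
  "(f, g, h) \<in> Tri sub \<longleftrightarrow> (f, g, h) \<in> Tri T \<and> Dom T f \<in> S \<and> Dom T g \<in> S \<and> Dom T h \<in> S"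
  using tri_candidate[of f g h] by (auto simp: mem_Tri_sub candidate_triangle_def sub_shift)

lemma triangle_morphism_sub:
  "triangle_morphism sub (f, g, h) (f', g', h') a b c \<longleftrightarrow>
   triangle_morphism T (f, g, h) (f', g', h') a b c \<and>
   Dom T f \<in> S \<and> Dom T g \<in> S \<and> Dom T h \<in> S \<and> Dom T f' \<in> S \<and> Dom T g' \<in> S \<and> Dom T h' \<in> S"
  by (auto simp: triangle_morphism_def mem_Hom_sub)

text \<open>
  As the full subcategory keeps the operations of T, the axioms restrict except where they assert that
  an object exists: zero objects, biproducts, desuspensions and cones. The closure properties of S
  provide these.
\<close>

lemma category_sub: "category sub"
proof unfold_locales
  fix f g h W X Y Z
  show "f \<in> Arr sub \<Longrightarrow> Dom sub f \<in> Obj sub \<and> Cod sub f \<in> Obj sub"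
    by (simp add: mem_Arr_sub)
  show "X \<in> Obj sub \<Longrightarrow> Ident sub X \<in> Hom sub X X"
    by (simp add: mem_Hom_sub ident_hom sub_obj)
  show "\<lbrakk>f \<in> Hom sub X Y; g \<in> Hom sub Y Z\<rbrakk> \<Longrightarrow> Comp sub g f \<in> Hom sub X Z"
    by (auto simp: mem_Hom_sub intro: comp_hom)
  show "f \<in> Hom sub X Y \<Longrightarrow> Comp sub f (Ident sub X) = f"
    "f \<in> Hom sub X Y \<Longrightarrow> Comp sub (Ident sub Y) f = f"
    by (auto simp: mem_Hom_sub intro: comp_ident_left comp_ident_right)
  show "\<lbrakk>f \<in> Hom sub W X; g \<in> Hom sub X Y; h \<in> Hom sub Y Z\<rbrakk> \<Longrightarrow>
      Comp sub h (Comp sub g f) = Comp sub (Comp sub h g) f"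
    by (auto simp: mem_Hom_sub intro: comp_assoc)
qed

lemma additive_category_sub: "additive_category sub"
proof (intro additive_category.intro additive_category_axioms.intro category_sub)
  fix X Y assume "X \<in> Obj sub" "Y \<in> Obj sub"
  then have X: "X \<in> S" and Y: "Y \<in> S" by simp_all
  show "comm_group (HomGroup sub X Y)"
    using hom_group X Y by (simp add: HomGroup_sub sub_obj)
  obtain P i1 i2 p1 p2 where b: "biproduct T X Y P i1 i2 p1 p2"
    using biproduct_exists[OF sub_obj[OF X] sub_obj[OF Y]] by auto
  have "P \<in> S"
    using sub_extension[OF biproduct_distinguished[OF b] X Y] .
  then show "\<exists>P i1 i2 p1 p2. biproduct sub X Y P i1 i2 p1 p2"
    using biproduct_sub[OF X Y \<open>P \<in> S\<close>] b by blast
next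
  show "\<exists>N. zero_object sub N"
    using zero_object_exists by (simp add: zero_object_sub)
qed (auto simp: mem_Hom_sub intro: comp_add_right comp_add_left)

lemma category_with_translation_sub: "category_with_translation sub"
proof (intro category_with_translation.intro category_with_translation_axioms.intro
    additive_category_sub)
  fix Y assume "Y \<in> Obj sub"
  then have Y: "Y \<in> S" by simp
  obtain X where X: "X \<in> Obj T" "isomorphic T (ShiftObj T X) Y"
    using shift_ess_surj[OF sub_obj[OF Y]] by auto
  have SX: "ShiftObj T X \<in> S" using sub_iso[OF Y isomorphic_sym[OF X(2)]] .
  then have "X \<in> S" using sub_unshift X(1) by simp
  then show "\<exists>X\<in>Obj sub. isomorphic sub (ShiftObj sub X) Y"
    using isomorphic_sub[OF SX Y] X(2) by auto
next
  fix X Y assume "X \<in> Obj sub" "Y \<in> Obj sub"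
  then have X: "X \<in> S" and Y: "Y \<in> S" by simp_all
  show "bij_betw (ShiftArr sub) (Hom sub X Y) (Hom sub (ShiftObj sub X) (ShiftObj sub Y))"
    using shift_fully_faithful[OF sub_obj[OF X] sub_obj[OF Y]]
    by (simp add: Hom_sub X Y sub_shift)
qed (auto simp: sub_shift shift_ident sub_obj mem_Hom_sub intro: shift_comp shift_add)

lemma triangulated_category_sub: "triangulated_category sub"
proof (intro triangulated_category.intro triangulated_category_axioms.intro
    category_with_translation_sub)
  fix f g h assume "(f, g, h) \<in> Tri sub"
  then show "candidate_triangle sub f g h"
    using tri_candidate by (simp add: Tri_sub_dom candidate_triangle_sub)
next
  fix f g h f' g' h' a b c
  assume t: "(f, g, h) \<in> Tri sub" and c: "candidate_triangle sub f' g' h'"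
    and m: "triangle_morphism sub (f, g, h) (f', g', h') a b c"
    and i: "is_iso sub a" "is_iso sub b" "is_iso sub c"
  have "a \<in> Arr sub" "b \<in> Arr sub" "c \<in> Arr sub"
    using i by (simp_all add: is_iso_def)
  then have "(f', g', h') \<in> Tri T"
    using TR1_iso[of f g h f' g' h' a b c] t c m i is_iso_sub
    by (simp add: Tri_sub_dom candidate_triangle_sub triangle_morphism_sub)
  then show "(f', g', h') \<in> Tri sub"
    using c by (simp add: Tri_sub_dom candidate_triangle_sub)
next
  fix X N assume "X \<in> Obj sub" and "zero_object sub N"
  then have X: "X \<in> S" and N: "zero_object T N" by (simp_all add: zero_object_sub)
  have NS: "N \<in> S" using sub_zero[OF N] .
  have "Ident T X \<in> Hom T X X" "ZeroArr T X N \<in> Hom T X N"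
    "ZeroArr T N (ShiftObj T X) \<in> Hom T N (ShiftObj T X)"
    using ident_hom zero_hom X NS sub_obj shift_obj by simp_all
  then show "(Ident sub X, ZeroArr sub X N, ZeroArr sub N (ShiftObj sub X)) \<in> Tri sub"
    using TR1_ident[OF sub_obj[OF X] N] X NS by (simp add: Tri_sub_dom Hom_def)
next
  fix f assume f: "f \<in> Arr sub"
  then have fh: "f \<in> Hom T (Dom T f) (Cod T f)" and fS: "Dom T f \<in> S" "Cod T f \<in> S"
    by (simp_all add: mem_Arr_sub Hom_def)
  obtain g h where t: "(f, g, h) \<in> Tri T"
    using TR1_cone[of f] f by (auto simp: mem_Arr_sub)
  have gh: "g \<in> Hom T (Cod T f) (Cod T g)" "h \<in> Hom T (Cod T g) (ShiftObj T (Dom T f))"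
    using tri_homs[OF t fh refl] by simp_all
  have "distinguished T (Dom T f) (Cod T f) (Cod T g)"
    unfolding distinguished_def using fh gh t by auto
  then have "Cod T g \<in> S" using sub_third fS by simp
  then have "(f, g, h) \<in> Tri sub"
    using t fS hom_dom_cod[OF gh(1)] hom_dom_cod[OF gh(2)] by (simp add: Tri_sub_dom)
  then show "\<exists>g h. (f, g, h) \<in> Tri sub" by auto
next
  fix f g h assume "candidate_triangle sub f g h"
  then have c: "candidate_triangle T f g h" and S: "Dom T f \<in> S" "Dom T g \<in> S" "Dom T h \<in> S"
    by (simp_all add: candidate_triangle_sub)
  have f: "f \<in> Hom T (Dom T f) (Dom T g)"
    using c by (simp add: candidate_triangle_def Hom_def)
  note sf = hom_dom_cod[OF shift_hom[OF f]]
  note nf = hom_dom_cod[OF Neg_hom[OF shift_hom[OF f]]]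
  show "(f, g, h) \<in> Tri sub \<longleftrightarrow> (g, h, Neg sub (ShiftArr sub f)) \<in> Tri sub"
    using TR2[OF c] S sf nf by (simp add: Tri_sub_dom Neg_sub sub_shift)
next
  fix f g h f' g' h' a b
  assume t: "(f, g, h) \<in> Tri sub" "(f', g', h') \<in> Tri sub"
    and a: "a \<in> Hom sub (Dom sub f) (Dom sub f')" and b: "b \<in> Hom sub (Cod sub f) (Cod sub f')"
    and e: "Comp sub b f = Comp sub f' a"
  obtain c where "triangle_morphism T (f, g, h) (f', g', h') a b c"
    using TR3[of f g h f' g' h' a b] t a b e by (auto simp: Tri_sub_dom mem_Hom_sub)
  then show "\<exists>c. triangle_morphism sub (f, g, h) (f', g', h') a b c"
    using t by (auto simp: triangle_morphism_sub Tri_sub_dom)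
next
  fix u X Y v Z i i' j j' k k'
  assume u: "u \<in> Hom sub X Y" and v: "v \<in> Hom sub Y Z"
    and t: "(u, i, i') \<in> Tri sub" "(v, j, j') \<in> Tri sub" "(Comp sub v u, k, k') \<in> Tri sub"
  have tT: "(u, i, i') \<in> Tri T" "(v, j, j') \<in> Tri T" "(Comp T v u, k, k') \<in> Tri T"
    using t by (simp_all add: Tri_sub_dom)
  have S: "Cod T i \<in> S" "Cod T j \<in> S" "Cod T k \<in> S"
    using t tri_candidate[OF tT(1)] tri_candidate[OF tT(2)] tri_candidate[OF tT(3)]
    by (auto simp: Tri_sub_dom candidate_triangle_def)
  have uT: "u \<in> Hom T X Y" and vT: "v \<in> Hom T Y Z" using u v by (simp_all add: mem_Hom_sub)
  obtain a b where ab: "a \<in> Hom T (Cod T i) (Cod T k)" "b \<in> Hom T (Cod T k) (Cod T j)"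
    "(a, b, Comp T (ShiftArr T i) j') \<in> Tri T"
    "Comp T a i = Comp T k v" "Comp T k' a = i'" "Comp T b k = j"
    "Comp T j' b = Comp T (ShiftArr T u) k'"
    using TR4[OF uT vT tT] by auto
  have j': "Dom T (Comp T (ShiftArr T i) j') = Cod T j"
    using tri_candidate[OF ab(3)] ab(2) by (simp add: candidate_triangle_def Hom_def)
  have "(a, b, Comp T (ShiftArr T i) j') \<in> Tri sub"
    using ab(1-3) S j' by (simp add: Tri_sub_dom Hom_def)
  then show "\<exists>a\<in>Hom sub (Cod sub i) (Cod sub k). \<exists>b\<in>Hom sub (Cod sub k) (Cod sub j).
      (a, b, Comp sub (ShiftArr sub i) j') \<in> Tri sub \<and>
      Comp sub a i = Comp sub k v \<and> Comp sub k' a = i' \<and>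
      Comp sub b k = j \<and> Comp sub j' b = Comp sub (ShiftArr sub u) k'"
    using ab S by (intro bexI[of _ a] bexI[of _ b]) (simp_all add: mem_Hom_sub)
qed

lemma orthogonal_sub: "\<lbrakk>X \<in> S; Y \<in> S\<rbrakk> \<Longrightarrow> orthogonal sub X Y \<longleftrightarrow> orthogonal T X Y"
  by (simp add: orthogonal_def Hom_sub)

lemma distinguished_sub:
  "distinguished sub X Y Z \<longleftrightarrow> distinguished T X Y Z \<and> X \<in> S \<and> Y \<in> S \<and> Z \<in> S"
proof -
  have "f \<in> Hom sub X Y \<and> g \<in> Hom sub Y Z \<and> h \<in> Hom sub Z (ShiftObj sub X) \<and>
      (f, g, h) \<in> Tri sub \<longleftrightarrow>
    (f \<in> Hom T X Y \<and> g \<in> Hom T Y Z \<and> h \<in> Hom T Z (ShiftObj T X) \<and> (f, g, h) \<in> Tri T) \<and>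
      X \<in> S \<and> Y \<in> S \<and> Z \<in> S" for f g h
    by (auto simp: Tri_sub_dom Hom_def mem_Arr_sub sub_shift)
  then show ?thesis
    unfolding distinguished_def Bex_def by blast
qed

lemma right_orthogonal_sub:
  "\<lbrakk>A \<subseteq> S; W \<in> S\<rbrakk> \<Longrightarrow> right_orthogonal sub A W \<longleftrightarrow> right_orthogonal T A W"
  using orthogonal_sub by (auto simp: right_orthogonal_def)

lemma strictly_full_sub: "strictly_full T A \<Longrightarrow> strictly_full sub (S \<inter> A)"
  using isomorphic_sub sub_obj by (auto simp: strictly_full_def)

end

section \<open>Restricting and gluing aisles\<close>

text \<open>
  The extensions of objects of B by objects of L. This will be the aisle of T that has L as a lower
  bound and restricts to the aisle B of the bounded part.
\<close>

definition glued_aisle :: "('o, 'm) tcat \<Rightarrow> 'o set \<Rightarrow> 'o set \<Rightarrow> 'o set" where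
  "glued_aisle T L B = {X. \<exists>P \<in> L. \<exists>Q \<in> B. distinguished T P X Q}"

context triangulated_category
begin

text \<open>
  The upper term W is bounded above as the cone of an arrow between objects that are bounded above,
  and bounded below because it is right orthogonal to A. The lower term X then follows by closure of
  the bounded part under triangles. Hence an aisle restricts to its bounded part.
\<close>

lemma bounded_part_truncation:
  assumes A: "aisle T A" and Z: "Z \<in> bounded_part T A"
    and X: "X \<in> A" "right_orthogonal T A W" "distinguished T X Z W"
  shows "X \<in> bounded_part T A" "W \<in> bounded_part T A"
proof -
  interpret S: triangulated_subcategory T "bounded_part T A"
    using bounded_part_triangulated[OF A] .
  obtain n where n: "(ShiftObj T ^^ n) Z \<in> A"
    using Z by (auto simp: bounded_part_def)
  show W: "W \<in> bounded_part T A"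
  proof (rule bounded_partI)
    show "W \<in> Obj T" using distinguished_obj[OF X(3)] by simp
    show "(ShiftObj T ^^ n) W \<in> A"
      using aisle_cone[OF A distinguished_shift_pow[OF X(3)] aisle_shift_pow[OF A X(1)] n] .
    show "orthogonal T ((ShiftObj T ^^ n) P) W" if "P \<in> A" for P
      using right_orthogonalD[OF X(2) aisle_shift_pow[OF A that]] .
  qed
  show "X \<in> bounded_part T A"
    using S.sub_first[OF X(3) Z W] .
qed

lemma commensurable_sym: "commensurable T A B \<Longrightarrow> commensurable T B A"
  unfolding commensurable_def by blast

lemma bounded_part_subset_if_commensurable:
  assumes "commensurable T A B" "aisle T A" "aisle T B"
  shows "bounded_part T A \<subseteq> bounded_part T B"
proof
  fix Y assume Y: "Y \<in> bounded_part T A"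
  obtain k where k: "Y \<in> Obj T" "(ShiftObj T ^^ k) Y \<in> A"
     "\<And>P. P \<in> A \<Longrightarrow> orthogonal T ((ShiftObj T ^^ k) P) Y"
    using Y by (auto simp: bounded_part_def)
  obtain n where n: "\<And>X. X \<in> A \<Longrightarrow> (ShiftObj T ^^ n) X \<in> B" "\<And>X. X \<in> B \<Longrightarrow> (ShiftObj T ^^ n) X \<in> A"
    using assms(1) by (auto simp: commensurable_def)
  show "Y \<in> bounded_part T B"
  proof (rule bounded_partI[OF k(1)])
    show "(ShiftObj T ^^ (n + k)) Y \<in> B"
      using n(1)[OF k(2)] by (simp add: funpow_add)
    show "orthogonal T ((ShiftObj T ^^ (n + k)) P) Y" if "P \<in> B" for P
      using k(3)[OF n(2)[OF that]] by (simp add: funpow_add add.commute[of n k])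
  qed
qed

lemma bounded_part_eq_if_commensurable:
  "\<lbrakk>commensurable T A B; aisle T A; aisle T B\<rbrakk> \<Longrightarrow> bounded_part T A = bounded_part T B"
  using bounded_part_subset_if_commensurable commensurable_sym by blast

lemma aisle_shift_class_nat:
  assumes A: "aisle T A"
  shows "aisle T (shift_class T (int n) A)"
  unfolding aisle_def shift_class_nat
proof (intro conjI ballI)
  let ?L = "{Y \<in> Obj T. \<exists>X \<in> A. isomorphic T ((ShiftObj T ^^ n) X) Y}"
  show "strictly_full T ?L"
    unfolding strictly_full_def using isomorphic_trans by blast
  show "ShiftObj T Y \<in> ?L" if Y: "Y \<in> ?L" for Y
  proof -
    obtain X where X: "Y \<in> Obj T" "X \<in> A" "isomorphic T ((ShiftObj T ^^ n) X) Y"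
      using Y by blast
    have "isomorphic T ((ShiftObj T ^^ n) (ShiftObj T X)) (ShiftObj T Y)"
      using isomorphic_shift[OF X(3)] by (simp add: funpow_swap1)
    then show ?thesis using shift_obj[OF X(1)] aisle_shift[OF A X(2)] by blast
  qed
  fix Z assume Z: "Z \<in> Obj T"
  obtain Z' where Z': "Z' \<in> Obj T" "isomorphic T ((ShiftObj T ^^ n) Z') Z"
    using shift_pow_ess_surj[OF Z] by blast
  obtain X W where X: "X \<in> A" "right_orthogonal T A W" "distinguished T X Z' W"
    using aisle_truncation[OF A Z'(1)] .
  note XO = shift_pow_obj[OF aisle_obj[OF A X(1)], of n]
  have "(ShiftObj T ^^ n) X \<in> ?L" using XO isomorphic_refl[OF XO] X(1) by blast
  moreover have "distinguished T ((ShiftObj T ^^ n) X) Z ((ShiftObj T ^^ n) W)"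
    using distinguished_iso_middle[OF distinguished_shift_pow[OF X(3)] Z'(2)] .
  moreover have "right_orthogonal T ?L ((ShiftObj T ^^ n) W)"
    unfolding right_orthogonal_def
  proof
    fix Y assume "Y \<in> ?L"
    then obtain P where P: "P \<in> A" "isomorphic T ((ShiftObj T ^^ n) P) Y" by blast
    have "W \<in> Obj T" using distinguished_obj[OF X(3)] by simp
    then have "orthogonal T ((ShiftObj T ^^ n) P) ((ShiftObj T ^^ n) W)"
      using orthogonal_shift_pow_iff[OF aisle_obj[OF A P(1)]] right_orthogonalD[OF X(2) P(1)]
      by blast
    then show "orthogonal T Y ((ShiftObj T ^^ n) W)" using orthogonal_iso_left P(2) by blast
  qed
  ultimately show "\<exists>X \<in> ?L. \<exists>W. right_orthogonal T ?L W \<and> distinguished T X Z W" by blast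
qed

lemma aisle_shift_class_neg:
  assumes A: "aisle T A"
  shows "aisle T (shift_class T (- int n) A)"
  unfolding aisle_def shift_class_neg[OF aisle_strictly_full[OF A]]
proof (intro conjI ballI)
  let ?H = "{Y \<in> Obj T. (ShiftObj T ^^ n) Y \<in> A}"
  show "strictly_full T ?H"
    unfolding strictly_full_def using aisle_iso[OF A _ isomorphic_shift_pow] by blast
  show "ShiftObj T Y \<in> ?H" if "Y \<in> ?H" for Y
    using that shift_obj aisle_shift[OF A, of "(ShiftObj T ^^ n) Y"] by (simp add: funpow_swap1)
  fix Z assume Z: "Z \<in> Obj T"
  obtain X W where X: "X \<in> A" "right_orthogonal T A W" "distinguished T X ((ShiftObj T ^^ n) Z) W"
    using aisle_truncation[OF A shift_pow_obj[OF Z]] .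
  have O: "X \<in> Obj T" "W \<in> Obj T" using distinguished_obj[OF X(3)] by auto
  obtain X' where X': "X' \<in> Obj T" "isomorphic T ((ShiftObj T ^^ n) X') X"
    using shift_pow_ess_surj[OF O(1)] by blast
  obtain W' where W': "W' \<in> Obj T" "isomorphic T ((ShiftObj T ^^ n) W') W"
    using shift_pow_ess_surj[OF O(2)] by blast
  have "distinguished T ((ShiftObj T ^^ n) X') ((ShiftObj T ^^ n) Z) ((ShiftObj T ^^ n) W')"
    using distinguished_iso_left[OF distinguished_iso_right[OF X(3)]] isomorphic_sym X'(2) W'(2)
    by blast
  then have "distinguished T X' Z W'"
    using distinguished_unshift_pow X'(1) Z W'(1) by blast
  moreover have "X' \<in> ?H" using X' aisle_iso[OF A X(1) isomorphic_sym[OF X'(2)]] by blast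
  moreover have "right_orthogonal T ?H W'"
    unfolding right_orthogonal_def
  proof
    fix P assume P: "P \<in> ?H"
    then have "orthogonal T ((ShiftObj T ^^ n) P) W" using right_orthogonalD[OF X(2)] by blast
    then have "orthogonal T ((ShiftObj T ^^ n) P) ((ShiftObj T ^^ n) W')"
      using orthogonal_iso_right isomorphic_sym[OF W'(2)] by blast
    then show "orthogonal T P W'" using orthogonal_shift_pow_iff P W'(1) by blast
  qed
  ultimately show "\<exists>X \<in> ?H. \<exists>W. right_orthogonal T ?H W \<and> distinguished T X Z W" by blast
qed

lemma commensurable_mono:
  assumes "aisle T A" "aisle T B" "m \<le> n"
    and "\<forall>X \<in> A. (ShiftObj T ^^ m) X \<in> B" "\<forall>X \<in> B. (ShiftObj T ^^ m) X \<in> A"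
  shows "\<forall>X \<in> A. (ShiftObj T ^^ n) X \<in> B" "\<forall>X \<in> B. (ShiftObj T ^^ n) X \<in> A"
  using assms aisle_shift_pow_mono by blast+

end

context triangulated_subcategory
begin

lemma aisle_restrict:
  assumes B: "aisle T B" and S: "bounded_part T B = S"
  shows "aisle sub (S \<inter> B)"
  unfolding aisle_def
proof (intro conjI ballI)
  show "strictly_full sub (S \<inter> B)"
    using strictly_full_sub[OF aisle_strictly_full[OF B]] .
  show "ShiftObj sub X \<in> S \<inter> B" if "X \<in> S \<inter> B" for X
    using that sub_shift aisle_shift[OF B] by simp
  fix Z assume "Z \<in> Obj sub"
  then have Z: "Z \<in> S" by simp
  obtain X W where X: "X \<in> B" "right_orthogonal T B W" "distinguished T X Z W"
    using aisle_truncation[OF B sub_obj[OF Z]] .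
  have XS: "X \<in> S" "W \<in> S"
    using bounded_part_truncation[OF B _ X] Z S by simp_all
  have "right_orthogonal sub (S \<inter> B) W"
    using X(2) XS(2) orthogonal_sub by (simp add: right_orthogonal_def)
  moreover have "distinguished sub X Z W"
    using X(3) XS Z by (simp add: distinguished_sub)
  ultimately show "\<exists>X\<in>S \<inter> B. \<exists>W. right_orthogonal sub (S \<inter> B) W \<and> distinguished sub X Z W"
    using X(1) XS(1) by blast
qed

text \<open>
  For bounded W the truncation P -> W is an arrow from a bounded object of B, hence zero. Every arrow
  from B to W factors through it. So orthogonality to all of B can be tested on bounded objects.
\<close>

lemma right_orthogonal_if_on_bounded:
  assumes B: "aisle T B" and S: "bounded_part T B = S"
    and W: "W \<in> S" "right_orthogonal T (S \<inter> B) W"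
  shows "right_orthogonal T B W"
  unfolding right_orthogonal_def
proof
  fix D assume D: "D \<in> B"
  obtain P C where P: "P \<in> B" "right_orthogonal T B C" "distinguished T P W C"
    using aisle_truncation[OF B sub_obj[OF W(1)]] .
  have "P \<in> S" using bounded_part_truncation(1)[OF B _ P] W(1) S by simp
  then have "orthogonal T P W" using right_orthogonalD[OF W(2)] P(1) by simp
  then show "orthogonal T D W"
    using orthogonal_if_factors_through_zero[OF P(3) right_orthogonalD[OF P(2) D]] by simp
qed

text \<open>
  Passing to a desuspension W of Y turns membership in a coaisle into orthogonality of W to the aisle,
  which bounded objects detect.
\<close>

lemma coaisle_restrict:
  assumes B: "aisle T B" and S: "bounded_part T B = S"
  shows "coaisle sub (S \<inter> B) = S \<inter> coaisle T B"
proof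
  show "S \<inter> coaisle T B \<subseteq> coaisle sub (S \<inter> B)"
    using orthogonal_sub sub_shift by (auto simp: coaisle_def)
  show "coaisle sub (S \<inter> B) \<subseteq> S \<inter> coaisle T B"
  proof
    fix Y assume "Y \<in> coaisle sub (S \<inter> B)"
    then have Y: "Y \<in> S" "\<And>X. X \<in> S \<inter> B \<Longrightarrow> orthogonal T (ShiftObj T X) Y"
      using orthogonal_sub sub_shift by (auto simp: coaisle_def)
    obtain W where W: "W \<in> Obj T" "isomorphic T (ShiftObj T W) Y"
      using shift_ess_surj[OF sub_obj[OF Y(1)]] by blast
    have WS: "W \<in> S" using sub_unshift[OF W(1)] sub_iso[OF Y(1) isomorphic_sym[OF W(2)]] by simp
    have "right_orthogonal T (S \<inter> B) W"
      unfolding right_orthogonal_def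
    proof
      fix X assume X: "X \<in> S \<inter> B"
      have "orthogonal T (ShiftObj T X) (ShiftObj T W)"
        using orthogonal_iso_right[OF Y(2)[OF X] isomorphic_sym[OF W(2)]] .
      then show "orthogonal T X W" using orthogonal_shift_iff sub_obj X W(1) by auto
    qed
    then have "ShiftObj T W \<in> coaisle T B"
      using right_orthogonal_if_on_bounded[OF B S WS] shift_mem_coaisle_iff[OF _ W(1)] aisle_obj[OF B]
      by blast
    then show "Y \<in> S \<inter> coaisle T B"
      using Y(1) strictly_full_iso[OF strictly_full_coaisle _ W(2)] by blast
  qed
qed

text \<open>
  An aisle B between L and a desuspension of L is determined by its bounded objects: the truncation
  of an object of B with respect to L has its upper term in B, and that term is bounded, above because
  B is not much larger than L and below because it is right orthogonal to L.
\<close>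

lemma aisle_eq_glued:
  assumes L: "aisle T L" "bounded_part T L = S" and B: "aisle T B" "L \<subseteq> B"
    and n: "\<And>X. X \<in> B \<Longrightarrow> (ShiftObj T ^^ n) X \<in> L"
  shows "B = glued_aisle T L (S \<inter> B)"
proof
  show "glued_aisle T L (S \<inter> B) \<subseteq> B"
    unfolding glued_aisle_def using aisle_extension[OF B(1)] B(2) by blast
  show "B \<subseteq> glued_aisle T L (S \<inter> B)"
  proof
    fix X assume X: "X \<in> B"
    obtain P C where P: "P \<in> L" "right_orthogonal T L C" "distinguished T P X C"
      using aisle_truncation[OF L(1) aisle_obj[OF B(1) X]] .
    have C: "C \<in> B" using aisle_cone[OF B(1) P(3) _ X] P(1) B(2) by blast
    have "C \<in> bounded_part T L"
      by (rule bounded_partI[OF aisle_obj[OF B(1) C] n[OF C]])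
        (rule right_orthogonalD[OF P(2) aisle_shift_pow[OF L(1)]])
    then show "X \<in> glued_aisle T L (S \<inter> B)"
      unfolding glued_aisle_def using L(2) C P by blast
  qed
qed

text \<open>
  The heart of the matter. To truncate Z with respect to the glued aisle, take its L-truncation
  P -> Z -> Z', then the H-truncation M -> Z' -> C. The middle piece M is bounded, so B provides
  M1 -> M -> M2. The lower term X of the sought triangle is the extension of M1 by P, the upper term
  W the extension of C by M2; two octahedra produce both extensions and the triangle X -> Z -> W.
  Orthogonality of L and M2 is not part of the truncation with respect to B, as objects of L may be
  unbounded; it follows from the case of bounded objects.
\<close>

lemma aisle_glued_aisle:
  assumes L: "aisle T L" "bounded_part T L = S"
    and H: "aisle T H" "L \<subseteq> H" "\<And>X. X \<in> H \<Longrightarrow> (ShiftObj T ^^ n) X \<in> L"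
    and B: "aisle sub B" "S \<inter> L \<subseteq> B" "B \<subseteq> H"
  shows "aisle T (glued_aisle T L B)" "L \<subseteq> glued_aisle T L B" "glued_aisle T L B \<subseteq> H"
    "S \<inter> glued_aisle T L B = B"
proof -
  interpret sub: triangulated_category sub using triangulated_category_sub .
  let ?G = "glued_aisle T L B"
  have BS: "X \<in> S" if "X \<in> B" for X using sub.aisle_obj[OF B(1) that] by simp
  obtain N where N: "zero_object T N" using zero_object_exists by blast
  have NL: "N \<in> L" using aisle_zero[OF L(1) N] .
  have NB: "N \<in> B" using NL sub_zero[OF N] B(2) by blast
  show LG: "L \<subseteq> ?G"
    unfolding glued_aisle_def using NB distinguished_ident[OF aisle_obj[OF L(1)] N] by blast
  show "?G \<subseteq> H"
    unfolding glued_aisle_def using aisle_extension[OF H(1)] H(2) B(3) by blast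
  show "S \<inter> ?G = B"
  proof
    show "B \<subseteq> S \<inter> ?G"
      unfolding glued_aisle_def using BS NL distinguished_zero_left[OF sub_obj[OF BS] N] by blast
    show "S \<inter> ?G \<subseteq> B"
    proof
      fix X assume "X \<in> S \<inter> ?G"
      then obtain P Q where X: "X \<in> S" "P \<in> L" "Q \<in> B" "distinguished T P X Q"
        by (auto simp: glued_aisle_def)
      have P: "P \<in> S" using sub_first[OF X(4,1) BS[OF X(3)]] .
      have "distinguished sub P X Q" using X P BS by (simp add: distinguished_sub)
      then show "X \<in> B"
        using sub.aisle_extension[OF B(1) _ _ X(3)] P X(2) B(2) by blast
    qed
  qed
  show "aisle T ?G"
    unfolding aisle_def
  proof (intro conjI ballI)
    show "strictly_full T ?G"
      unfolding strictly_full_def glued_aisle_def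
      using distinguished_obj distinguished_iso_middle by blast
    show "ShiftObj T X \<in> ?G" if "X \<in> ?G" for X
      using that distinguished_shift aisle_shift[OF L(1)] sub.aisle_shift[OF B(1)]
      unfolding glued_aisle_def by fastforce
    fix Z assume Z: "Z \<in> Obj T"
    obtain P Z' where P: "P \<in> L" "right_orthogonal T L Z'" "distinguished T P Z Z'"
      using aisle_truncation[OF L(1) Z] .
    have Z': "Z' \<in> Obj T" using distinguished_obj[OF P(3)] by simp
    obtain M C where M: "M \<in> H" "right_orthogonal T H C" "distinguished T M Z' C"
      using aisle_truncation[OF H(1) Z'] .
    \<comment> \<open>M is right orthogonal to L because Z' and, up to desuspension, C are.\<close>
    have LM: "orthogonal T D M" if D: "D \<in> L" for D
      by (rule orthogonal_first[OF M(3) aisle_obj[OF L(1) D] right_orthogonalD[OF P(2) D]])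
        (use right_orthogonalD[OF M(2)] aisle_shift[OF L(1) D] H(2) in blast)
    have "M \<in> bounded_part T L"
      by (rule bounded_partI[OF aisle_obj[OF H(1) M(1)] H(3)[OF M(1)]])
        (rule LM[OF aisle_shift_pow[OF L(1)]])
    then have MS: "M \<in> S" using L(2) by simp
    obtain M1 M2 where M12: "M1 \<in> B" "right_orthogonal sub B M2" "distinguished sub M1 M M2"
      using sub.aisle_truncation[OF B(1)] MS by auto
    have dM: "distinguished T M1 M M2" and M2S: "M2 \<in> S"
      using M12(3) by (auto simp: distinguished_sub)
    \<comment> \<open>The composite M1 -> M -> Z' has cone W, an extension of C by M2.\<close>
    obtain W where W: "distinguished T M1 Z' W" "distinguished T M2 W C"
      using octahedron[OF dM M(3)] .
    \<comment> \<open>The composite Z -> Z' -> W has cone \<Sigma>X, an extension of \<Sigma>M1 by \<Sigma>P.\<close>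
    obtain Q where Q: "distinguished T Z W Q" "distinguished T (ShiftObj T P) Q (ShiftObj T M1)"
      using octahedron[OF distinguished_rotate[OF P(3)] distinguished_rotate[OF W(1)]] .
    obtain X where X: "X \<in> Obj T" "isomorphic T (ShiftObj T X) Q"
      using shift_ess_surj distinguished_obj[OF Q(1)] by blast
    have dX: "distinguished T X Z W"
      using distinguished_unrotate[OF distinguished_iso_right[OF Q(1) isomorphic_sym[OF X(2)]] X(1)] .
    have "distinguished T P X M1"
      using distinguished_unshift[OF distinguished_iso_middle[OF Q(2) isomorphic_sym[OF X(2)]]]
        aisle_obj[OF L(1) P(1)] X(1) sub_obj[OF BS[OF M12(1)]] by blast
    then have XG: "X \<in> ?G" unfolding glued_aisle_def using P(1) M12(1) by blast
    have oB: "right_orthogonal T B M2"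
      using M12(2) right_orthogonal_sub[OF _ M2S] BS by blast
    then have oL: "right_orthogonal T L M2"
      using right_orthogonal_if_on_bounded[OF L M2S] B(2) by (auto simp: right_orthogonal_def)
    have "right_orthogonal T ?G W"
      unfolding right_orthogonal_def
    proof
      fix D assume "D \<in> ?G"
      then obtain D1 D2 where D: "D1 \<in> L" "D2 \<in> B" "distinguished T D1 D D2"
        by (auto simp: glued_aisle_def)
      have "orthogonal T D1 W"
        by (rule orthogonal_extension_right[OF W(2) right_orthogonalD[OF oL D(1)]])
          (use right_orthogonalD[OF M(2)] D(1) H(2) in blast)
      moreover have "orthogonal T D2 W"
        by (rule orthogonal_extension_right[OF W(2) right_orthogonalD[OF oB D(2)]])
          (use right_orthogonalD[OF M(2)] D(2) B(3) in blast)
      ultimately show "orthogonal T D W" using orthogonal_extension_left[OF D(3)] by blast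
    qed
    then show "\<exists>X\<in>?G. \<exists>W. right_orthogonal T ?G W \<and> distinguished T X Z W"
      using XG dX by blast
  qed
qed

end

section \<open>Distance and the correspondence\<close>

context triangulated_category
begin

text \<open>
  The inclusions defining the distance involve some integer shift. Since aisles are closed under
  \<Sigma>, they persist when the shifts become more extreme, so one natural number n serves both.
\<close>

lemma t_distance_finite_iff:
  assumes "t_structure T U" "t_structure T V"
  shows "t_distance T U V < \<infinity> \<longleftrightarrow> commensurable T (fst U) (fst V)"
proof -
  have U: "aisle T (fst U)" and V: "aisle T (fst V)" using assms by (auto simp: t_structure_iff)
  note neg = shift_class_neg[OF aisle_strictly_full[OF V]]
  have U0: "t_le T U 0 = fst U"
    using shift_class_neg[OF aisle_strictly_full[OF U], of 0] aisle_obj[OF U] by (auto simp: t_le_def)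
  have "t_distance T U V < \<infinity> \<longleftrightarrow>
    (\<exists>d m. t_le T V m \<subseteq> fst U \<and> fst U \<subseteq> t_le T V (m + int d))"
    unfolding t_distance_def Inf_less_iff U0 by auto
  also have "\<dots> \<longleftrightarrow> commensurable T (fst U) (fst V)"
  proof
    assume "\<exists>d m. t_le T V m \<subseteq> fst U \<and> fst U \<subseteq> t_le T V (m + int d)"
    then obtain d m where dm: "t_le T V m \<subseteq> fst U" "fst U \<subseteq> t_le T V (m + int d)" by blast
    \<comment> \<open>Suspending -m times moves the aisle of V into that of U; suspending m + d times goes the other way.\<close>
    define n where "n = nat (max (- m) (m + int d))"
    have "(ShiftObj T ^^ n) X \<in> fst U" if X: "X \<in> fst V" for X
    proof (rule aisle_shift_pow_mono[OF U])
      show "nat (- m) \<le> n" by (auto simp: n_def)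
      have XO: "X \<in> Obj T" using aisle_obj[OF V X] .
      have "(ShiftObj T ^^ nat (- m)) X \<in> t_le T V m"
      proof (cases "m \<le> 0")
        case True
        note YO = shift_pow_obj[OF XO, of "nat (- m)"]
        show ?thesis
          using shift_class_nat[of "nat (- m)" "fst V"] True YO isomorphic_refl[OF YO] X
          by (auto simp: t_le_def)
      next
        case False
        then show ?thesis
          using neg[of "nat m"] XO aisle_shift_pow[OF V X] by (auto simp: t_le_def)
      qed
      then show "(ShiftObj T ^^ nat (- m)) X \<in> fst U" using dm(1) by blast
    qed
    moreover have "(ShiftObj T ^^ n) X \<in> fst V" if X: "X \<in> fst U" for X
    proof (rule aisle_shift_pow_mono[OF V])
      show "nat (m + int d) \<le> n" by (auto simp: n_def)
      have X': "X \<in> t_le T V (m + int d)" using dm(2) X by blast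
      show "(ShiftObj T ^^ nat (m + int d)) X \<in> fst V"
      proof (cases "m + int d \<ge> 0")
        case True
        then show ?thesis using X' neg[of "nat (m + int d)"] by (auto simp: t_le_def)
      next
        case False
        then obtain X0 where "X0 \<in> fst V" "isomorphic T ((ShiftObj T ^^ nat (- (m + int d))) X0) X"
          using X' shift_class_nat[of "nat (- (m + int d))" "fst V"] by (auto simp: t_le_def)
        then show ?thesis using False aisle_iso[OF V aisle_shift_pow[OF V]] by simp
      qed
    qed
    ultimately show "commensurable T (fst U) (fst V)" by (auto simp: commensurable_def)
  next
    assume "commensurable T (fst U) (fst V)"
    then obtain n where n: "\<And>X. X \<in> fst U \<Longrightarrow> (ShiftObj T ^^ n) X \<in> fst V"
        "\<And>X. X \<in> fst V \<Longrightarrow> (ShiftObj T ^^ n) X \<in> fst U"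
      by (auto simp: commensurable_def)
    have "t_le T V (- int n) \<subseteq> fst U"
      using aisle_iso[OF U n(2)] by (auto simp: t_le_def shift_class_nat)
    moreover have "fst U \<subseteq> t_le T V (- int n + int (2 * n))"
      using n(1) aisle_obj[OF U] by (auto simp: t_le_def neg)
    \<comment> \<open>Take m = - n and d = 2 n, so that m + d = n.\<close>
    ultimately show "\<exists>d m. t_le T V m \<subseteq> fst U \<and> fst U \<subseteq> t_le T V (m + int d)" by blast
  qed
  finally show ?thesis .
qed

end

context triangulated_subcategory
begin

lemma t_structure_restrict:
  assumes "t_structure T V" "bounded_part T (fst V) = S"
  shows "t_structure sub (t_restrict S V)"
proof -
  interpret sub: triangulated_category sub using triangulated_category_sub .
  show ?thesis
    using assms aisle_restrict coaisle_restrict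
    by (auto simp: t_structure_iff sub.t_structure_iff t_restrict_def)
qed

lemma bounded_t_structure_restrict:
  assumes V: "t_structure T V" and S: "bounded_part T (fst V) = S"
  shows "bounded_t_structure sub (t_restrict S V)"
proof -
  interpret sub: triangulated_category sub using triangulated_category_sub .
  let ?V = "t_restrict S V"
  have t: "t_structure sub ?V" using t_structure_restrict[OF V S] .
  have A: "aisle T (fst V)" and co: "snd V = coaisle T (fst V)" using V by (auto simp: t_structure_iff)
  have At: "aisle sub (fst ?V)" using t by (simp add: sub.t_structure_iff)
  have le: "t_le sub ?V n \<subseteq> S" and ge: "t_ge sub ?V n \<subseteq> S" for n
    by (auto simp: t_le_def t_ge_def shift_class_def)
  have "\<exists>n. Y \<in> t_le sub ?V n" "\<exists>n. Y \<in> t_ge sub ?V n" if Y: "Y \<in> S" for Y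
  proof -
    obtain n where n: "(ShiftObj T ^^ n) Y \<in> fst V"
        "\<And>P. P \<in> fst V \<Longrightarrow> orthogonal T ((ShiftObj T ^^ n) P) Y"
      using Y unfolding S[symmetric] by (auto simp: bounded_part_def)
    have "Y \<in> t_le sub ?V (int n)"
      using sub.shift_class_neg[OF sub.aisle_strictly_full[OF At], of n] Y n(1) sub_shift_pow
      by (simp add: t_le_def t_restrict_def)
    then show "\<exists>n. Y \<in> t_le sub ?V n" ..
    obtain X where X: "X \<in> Obj T" "isomorphic T ((ShiftObj T ^^ n) X) Y"
      using shift_pow_ess_surj[OF sub_obj[OF Y]] by blast
    have SX: "(ShiftObj T ^^ n) X \<in> S" using sub_iso[OF Y isomorphic_sym[OF X(2)]] .
    have "orthogonal T P X" if "P \<in> fst V" for P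
      using orthogonal_iso_right[OF n(2)[OF that] isomorphic_sym[OF X(2)]]
        orthogonal_shift_pow_iff[OF aisle_obj[OF A that] X(1)] by blast
    then have "X \<in> coaisle T (fst V)"
      using X(1) aisle_shift[OF A] by (auto simp: coaisle_def)
    then have "X \<in> snd ?V" using sub_unshift_pow[OF X(1) SX] by (simp add: t_restrict_def co)
    then have "Y \<in> t_ge sub ?V (- int n)"
      using sub.shift_class_nat[of n "snd ?V"] isomorphic_sub[OF SX Y] X(2) Y by (auto simp: t_ge_def)
    then show "\<exists>n. Y \<in> t_ge sub ?V n" ..
  qed
  then show ?thesis
    unfolding bounded_t_structure_def using t le ge by fastforce
qed

text \<open>
  Two aisles at finite distance from A have a common lower bound L, a high suspension of A, and both
  are recovered from L and their bounded objects.
\<close>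

lemma aisle_determined_by_bounded_part:
  assumes A: "aisle T A" "bounded_part T A = S"
    and B: "aisle T B" "commensurable T A B" and C: "aisle T C" "commensurable T A C"
    and eq: "S \<inter> B = S \<inter> C"
  shows "B = C"
proof -
  obtain k where k: "\<forall>X \<in> A. (ShiftObj T ^^ k) X \<in> B" "\<forall>X \<in> B. (ShiftObj T ^^ k) X \<in> A"
    using B(2) by (auto simp: commensurable_def)
  obtain l where l: "\<forall>X \<in> A. (ShiftObj T ^^ l) X \<in> C" "\<forall>X \<in> C. (ShiftObj T ^^ l) X \<in> A"
    using C(2) by (auto simp: commensurable_def)
  define n where "n = max k l"
  define L where "L = shift_class T (int n) A"
  have L: "aisle T L" unfolding L_def using aisle_shift_class_nat[OF A(1)] .
  have AL: "(ShiftObj T ^^ n) X \<in> L" if "X \<in> A" for X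
    unfolding L_def shift_class_nat
    using that isomorphic_refl shift_pow_obj[OF aisle_obj[OF A(1) that]] by blast
  have "L \<subseteq> A" 
    unfolding L_def shift_class_nat using aisle_iso[OF A(1) aisle_shift_pow[OF A(1)]] by blast
  then have "commensurable T A L"
    unfolding commensurable_def using AL aisle_shift_pow[OF A(1)] by blast
  then have bL: "bounded_part T L = S"
    using bounded_part_eq_if_commensurable[OF _ A(1) L] A(2) by simp
  have *: "D = glued_aisle T L (S \<inter> D)"
    if D: "aisle T D" and m: "m \<le> n" "\<forall>X \<in> A. (ShiftObj T ^^ m) X \<in> D"
      "\<forall>X \<in> D. (ShiftObj T ^^ m) X \<in> A" for D m
  proof (rule aisle_eq_glued[OF L bL D])
    note n = commensurable_mono[OF A(1) D m]
    show "L \<subseteq> D"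
      unfolding L_def shift_class_nat using n(1) aisle_iso[OF D] by blast
    show "(ShiftObj T ^^ (n + n)) X \<in> L" if "X \<in> D" for X
      using AL n(2) that by (simp add: funpow_add)
  qed
  show ?thesis
    using *[OF B(1) _ k] *[OF C(1) _ l] eq by (simp add: n_def)
qed

text \<open>
  Here L and H are the n-fold suspension and desuspension of A, where n witnesses that B is
  commensurable with the restriction of A. They have the same bounded part as A and enclose B on it.
\<close>

lemma aisle_extends_from_bounded_part:
  assumes A: "aisle T A" "bounded_part T A = S"
    and B: "aisle sub B" "commensurable sub (S \<inter> A) B"
  obtains D where "aisle T D" "commensurable T A D" "S \<inter> D = B"
proof -
  interpret sub: triangulated_category sub using triangulated_category_sub .
  have BS: "X \<in> S" if "X \<in> B" for X using sub.aisle_obj[OF B(1) that] by simp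
  obtain n where n: "\<And>X. X \<in> S \<inter> A \<Longrightarrow> (ShiftObj T ^^ n) X \<in> B"
      "\<And>X. X \<in> B \<Longrightarrow> (ShiftObj T ^^ n) X \<in> S \<inter> A"
    using B(2) by (auto simp: commensurable_def)
  define L where "L = shift_class T (int n) A"
  define H where "H = shift_class T (- int n) A"
  have L: "aisle T L" unfolding L_def using aisle_shift_class_nat[OF A(1)] .
  have H: "aisle T H" unfolding H_def using aisle_shift_class_neg[OF A(1)] .
  have Heq: "H = {Y \<in> Obj T. (ShiftObj T ^^ n) Y \<in> A}"
    unfolding H_def using shift_class_neg[OF aisle_strictly_full[OF A(1)]] .
  have Leq: "L = {Y \<in> Obj T. \<exists>X \<in> A. isomorphic T ((ShiftObj T ^^ n) X) Y}"
    unfolding L_def using shift_class_nat .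
  have AL: "(ShiftObj T ^^ n) X \<in> L" if "X \<in> A" for X
    unfolding Leq
    using that isomorphic_refl shift_pow_obj[OF aisle_obj[OF A(1) that]] by blast
  have LA: "L \<subseteq> A"
    unfolding Leq using aisle_iso[OF A(1) aisle_shift_pow[OF A(1)]] by blast
  have AH: "A \<subseteq> H"
    unfolding Heq using aisle_shift_pow[OF A(1)] aisle_obj[OF A(1)] by blast
  have "commensurable T A L"
    unfolding commensurable_def using AL LA aisle_shift_pow[OF A(1)] by blast
  then have bL: "bounded_part T L = S"
    using bounded_part_eq_if_commensurable[OF _ A(1) L] A(2) by simp
  have HL: "(ShiftObj T ^^ (n + n)) X \<in> L" if "X \<in> H" for X
    using AL that by (simp add: funpow_add Heq)
  have SL: "S \<inter> L \<subseteq> B"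
  proof
    fix Y assume Y: "Y \<in> S \<inter> L"
    then obtain X where X: "X \<in> A" "isomorphic T ((ShiftObj T ^^ n) X) Y" by (auto simp: Leq)
    have SX: "(ShiftObj T ^^ n) X \<in> S" using sub_iso isomorphic_sym[OF X(2)] Y by blast
    then have "X \<in> S" using sub_unshift_pow aisle_obj[OF A(1) X(1)] by blast
    then have "(ShiftObj T ^^ n) X \<in> B" using n(1) X(1) by blast
    then show "Y \<in> B" using sub.aisle_iso[OF B(1)] isomorphic_sub[OF SX] X(2) Y by blast
  qed
  have BH: "B \<subseteq> H" using n(2) sub_obj[OF BS] by (auto simp: Heq)
  have LH: "L \<subseteq> H" using LA AH by blast
  note G = aisle_glued_aisle[OF L bL H LH HL B(1) SL BH]
  have "commensurable T A (glued_aisle T L B)"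
    unfolding commensurable_def using AL G(2,3) by (auto simp: Heq intro!: exI[of _ n])
  then show thesis using that G(1,4) by blast
qed

end

theorem theorem5p1:
  fixes T :: "('o, 'm) tcat" and U :: "'o set \<times> 'o set"
  assumes "triangulated_category T" and "t_structure T U"
  shows "let S = t_bounded_objects T U;
             Tb = full_subcategory T S;
             Ub = t_restrict S U
         in bounded_t_structure Tb Ub \<and>
            bij_betw (t_restrict S)
              {V. t_structure T V \<and> t_distance T U V < \<infinity>}
              {V'. t_structure Tb V' \<and> t_distance Tb Ub V' < \<infinity>}"
proof -
  interpret triangulated_category T by fact
  note U = assms(2)
  have A: "aisle T (fst U)" using U by (simp add: t_structure_iff)
  define S where "S = t_bounded_objects T U"
  have S: "bounded_part T (fst U) = S" using t_bounded_objects_eq[OF U] by (simp add: S_def)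
  interpret triangulated_subcategory T S
    using bounded_part_triangulated[OF A] by (simp add: S)
  interpret sub: triangulated_category sub using triangulated_category_sub .
  let ?Ub = "t_restrict S U"
  let ?P = "{V. t_structure T V \<and> t_distance T U V < \<infinity>}"
  let ?Q = "{V'. t_structure sub V' \<and> t_distance sub ?Ub V' < \<infinity>}"
  have Ub: "t_structure sub ?Ub" using t_structure_restrict[OF U S] .
  have P: "V \<in> ?P \<longleftrightarrow>
      aisle T (fst V) \<and> snd V = coaisle T (fst V) \<and> commensurable T (fst U) (fst V)" for V
    using t_distance_finite_iff[OF U, of V] t_structure_iff[of V] by blast
  have Q: "V \<in> ?Q \<longleftrightarrow> aisle sub (fst V) \<and> snd V = coaisle sub (fst V) \<and>
      commensurable sub (S \<inter> fst U) (fst V)" for V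
    using sub.t_distance_finite_iff[OF Ub, of V] sub.t_structure_iff[of V]
    by (auto simp: t_restrict_def)
  have bdd: "bounded_part T B = S" if "aisle T B" "commensurable T (fst U) B" for B
    using bounded_part_eq_if_commensurable[OF that(2) A that(1)] S by simp
  have restrict: "t_restrict S V \<in> ?Q" if V: "V \<in> ?P" for V
  proof -
    have "commensurable sub (S \<inter> fst U) (S \<inter> fst V)"
      using V sub_shift_pow unfolding P commensurable_def by fastforce
    then show ?thesis
      using V aisle_restrict coaisle_restrict bdd unfolding P Q by (simp add: t_restrict_def)
  qed
  have "bij_betw (t_restrict S) ?P ?Q"
    unfolding bij_betw_def
  proof
    show "inj_on (t_restrict S) ?P"
    proof (rule inj_onI)
      fix V W assume V: "V \<in> ?P" and W: "W \<in> ?P" and eq: "t_restrict S V = t_restrict S W"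
      have "fst V = fst W"
        using aisle_determined_by_bounded_part[OF A S] V W eq unfolding P by (simp add: t_restrict_def)
      then show "V = W" using V W unfolding P by (simp add: prod_eq_iff)
    qed
    show "t_restrict S ` ?P = ?Q"
    proof
      show "t_restrict S ` ?P \<subseteq> ?Q" using restrict by blast
      show "?Q \<subseteq> t_restrict S ` ?P"
      proof
        fix V assume V: "V \<in> ?Q"
        obtain D where D: "aisle T D" "commensurable T (fst U) D" "S \<inter> D = fst V"
          using aisle_extends_from_bounded_part[OF A S] V unfolding Q by blast
        have "(D, coaisle T D) \<in> ?P" unfolding P using D by simp
        moreover have "t_restrict S (D, coaisle T D) = V"
          using D V coaisle_restrict[OF D(1) bdd[OF D(1,2)]] unfolding Q
          by (simp add: t_restrict_def prod_eq_iff)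
        ultimately show "V \<in> t_restrict S ` ?P" by blast
      qed
    qed
  qed
  then show ?thesis
    unfolding Let_def S_def[symmetric] using bounded_t_structure_restrict[OF U S] by blast
qed

end
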